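(* For $0<\delta<1$ and $n=1,2,3,\dots$, the $n$th cumulant $\kappa_n(\delta)$ of $-\log\beta_{2,2}(\delta)$ is $$\kappa_n(\delta)=\frac18\sum_{m=0}^\infty\frac{\bigl(-(\delta-1/2)\bigr)^m}{m!}\,32^{(m+n)/2}\,\Gamma\Bigl(\frac{m+n}{2}\Bigr)\,\mathbf{E}\bigl[C_2^{-(m+n)/2}\bigr].$$ In particular, for $\delta=1/2$, $$\kappa_n(1/2)=\frac{32^{n/2}}{8}\,\Gamma\Bigl(\frac n2\Bigr)\,\frac{2^{2-n}-1}{1-n/2}\Bigl(\frac2\pi\Bigr)^{1-n/2}\xi(n-1),$$ where for $n=2$ the ratio $(2^{2-n}-1)/(1-n/2)$ is understood as its limit $2\log 2$.
   Context: $\beta_{2,2}(\delta)$, $\delta>0$, is the Barnes beta distribution $\beta_{2,2}$ with $a=(1,1)$, $b_0=\delta$, $b_1=b_2=1/2$: the probability distribution on $(0,1]$ with, for $\Re(q)>-\delta$, $$\mathbf{E}[\beta_{2,2}(\delta)^q]=\frac{G(\delta)}{G(q+\delta)}\frac{G^2(q+\delta+1/2)}{G^2(\delta+1/2)}\frac{G(\delta+1)}{G(q+\delta+1)}=\exp\Bigl(\int_0^\infty(e^{-tq}-1)e^{-\delta t}\frac{(1-e^{-t/2})^2}{(1-e^{-t})^2}\frac{dt}{t}\Bigr),$$ where $G$ is the Barnes $G$ function. Its cumulants are $\kappa_n(\delta)=(-1)^n\frac{d^n}{dq^n}\big|_{q=0}\log\mathbf{E}[\beta_{2,2}(\delta)^q]$.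 $C_2$ is the positive random variable with Laplace transform $\mathbf{E}[e^{-qC_2}]=\bigl(1/\cosh\sqrt{2q}\bigr)^2$, $q>0$; all its real moments (positive and negative) are finite. The Riemann xi function is $\xi(q)=\frac12q(q-1)\pi^{-q/2}\Gamma(q/2)\zeta(q)$ (entire, removable singularities filled in). *)

theory Defs
  imports "HOL-Probability.Probability" "HOL-Complex_Analysis.Complex_Analysis"
begin

text \<open>
  The Barnes G function by its Weierstrass product, normalised by \<open>G(1) = 1\<close> and
  \<open>G(w + 1) = \<Gamma>(w) G(w)\<close>; the classical product for \<open>G(1 + w)\<close> is evaluated at \<open>w = z - 1\<close>.
\<close>

definition barnes_G :: "complex \<Rightarrow> complex" where
  "barnes_G z = (let w = z - 1 in
     of_real (2 * pi) powr (w / 2) * exp (- (w + w\<^sup>2 * (1 + euler_mascheroni)) / 2) *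
     prodinf (\<lambda>k. (1 + w / of_nat (Suc k)) ^ Suc k * exp (w\<^sup>2 / (2 * of_nat (Suc k)) - w)))"

text \<open>
  The Riemann zeta function: the analytic continuation of the Dirichlet series to the punctured
  plane.  The continuation is unique away from the pole; the value at \<open>1\<close> is unspecified and is
  never used.
\<close>

definition riemann_zeta :: "complex \<Rightarrow> complex" where
  "riemann_zeta = (SOME f. f holomorphic_on (- {1}) \<and>
     (\<forall>s. Re s > 1 \<longrightarrow> (\<lambda>n. 1 / of_nat (Suc n) powr s) sums f s))"

definition riemann_xi :: "complex \<Rightarrow> complex" where
  "riemann_xi = remove_sings
     (\<lambda>q. 1 / 2 * q * (q - 1) * of_real pi powr (- q / 2) * Gamma (q / 2) * riemann_zeta q)"

definition mellin :: "real measure \<Rightarrow> complex \<Rightarrow> complex" where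
  "mellin M q = (LINT x|M. complex_of_real x powr q)"

text \<open>
  The law of \<open>\<beta>\<^sub>2\<^sub>,\<^sub>2\<close> with \<open>a = (1,1)\<close>, \<open>b\<^sub>0 = \<delta>\<close>, \<open>b\<^sub>1 = b\<^sub>2 = 1/2\<close>.  Both expressions for the Mellin
  transform are part of the description; \<open>M\<close> is determined by it.
\<close>

definition barnes_beta_22 :: "real \<Rightarrow> real measure \<Rightarrow> bool" where
  "barnes_beta_22 \<delta> M \<longleftrightarrow>
     prob_space M \<and> sets M = sets borel \<and> (AE x in M. x \<in> {0<..1}) \<and>
     (\<forall>q. Re q > - \<delta> \<longrightarrow>
        mellin M q =
          barnes_G (of_real \<delta>) / barnes_G (q + of_real \<delta>) *
          ((barnes_G (q + of_real \<delta> + 1 / 2))\<^sup>2 / (barnes_G (of_real \<delta> + 1 / 2))\<^sup>2) *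
          (barnes_G (of_real \<delta> + 1) / barnes_G (q + of_real \<delta> + 1)) \<and>
        mellin M q =
          exp (LINT t:{0<..}|lborel. (exp (- (of_real t * q)) - 1) *
                 of_real (exp (- (\<delta> * t)) * ((1 - exp (- t / 2))\<^sup>2 / (1 - exp (- t))\<^sup>2) / t)))"

text \<open>
  The \<open>n\<close>th cumulant of \<open>- log X\<close> for \<open>X\<close> with law \<open>M\<close>.  The Mellin transform equals \<open>1\<close> at \<open>q = 0\<close>,
  so the principal logarithm is the right branch nearby.
\<close>

definition neg_log_cumulant :: "real measure \<Rightarrow> nat \<Rightarrow> complex" where
  "neg_log_cumulant M n = (- 1) ^ n * (deriv ^^ n) (\<lambda>q. Ln (mellin M q)) 0"

definition C2_variable :: "'a measure \<Rightarrow> ('a \<Rightarrow> real) \<Rightarrow> bool" where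
  "C2_variable N C \<longleftrightarrow>
     prob_space N \<and> C \<in> borel_measurable N \<and> (AE \<omega> in N. 0 < C \<omega>) \<and>
     (\<forall>q>0. (LINT \<omega>|N. exp (- (q * C \<omega>))) = (1 / cosh (sqrt (2 * q)))\<^sup>2)"

end

theory Submission
  imports Defs "HOL-Real_Asymp.Real_Asymp"
begin

text \<open>
  The logarithm of the Mellin transform is \<open>\<integral> (e\<^sup>-\<^sup>t\<^sup>q - 1) v(t) dt/t\<close> with
  \<open>v(t) = e\<^sup>-\<^sup>\<delta>\<^sup>t / (1 + e\<^sup>-\<^sup>t\<^sup>/\<^sup>2)\<^sup>2\<close>; expanding in powers of \<open>q\<close> under the integral shows that the \<open>n\<close>th
  cumulant is \<open>\<integral> t\<^sup>n\<^sup>-\<^sup>1 v(t) dt\<close>.  Since \<open>v(t) = e\<^sup>-\<^sup>(\<^sup>\<delta>\<^sup>-\<^sup>1\<^sup>/\<^sup>2\<^sup>)\<^sup>t / (4 cosh\<^sup>2 (t/4))\<close> and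
  \<open>1 / cosh\<^sup>2 (t/4)\<close> is the Laplace transform of \<open>C\<^sub>2\<close> at \<open>t\<^sup>2/32\<close>, expanding the exponential and
  exchanging expectation and integral leaves Gaussian moments, which produce the series.
  For \<open>\<delta> = 1/2\<close> the integral is elementary if \<open>n \<le> 2\<close>, and for \<open>n \<ge> 3\<close> a geometric expansion turns it
  into the alternating zeta series, which the duplication formula matches with \<open>\<xi>\<close>.
  The continuation of \<open>\<zeta>\<close>, needed for \<open>\<xi>(0)\<close> and \<open>\<xi>(1)\<close>, comes from splitting the integral
  \<open>\<Gamma>(s) \<zeta>(s) = \<integral> t\<^sup>s\<^sup>-\<^sup>1 / (e\<^sup>t - 1) dt\<close> at \<open>t = 1\<close> and expanding \<open>t / (e\<^sup>t - 1) = \<Sum>k. b\<^sub>k t\<^sup>k\<close> on the first piece: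
  \<open>\<zeta>(s) = (\<Sum>k. b\<^sub>k / (s + k - 1) + \<integral>\<^sub>1 t\<^sup>s\<^sup>-\<^sup>1 / (e\<^sup>t - 1) dt) / \<Gamma>(s)\<close>.
\<close>

section \<open>Integrals and power series\<close>

text \<open>The bound on \<open>c\<close> lets the series \<open>exp (R * \<bar>g x\<bar>)\<close>
  dominate all partial sums at once, so integrability of that single function justifies the termwise
  integration. It serves three expansions: the logarithm of the Mellin transform in
  \<open>q\<close>, the factor exp(-(\<delta> - 1/2) t), and t^s = exp(s ln t) in the tail of
  zeta.\<close>

lemma integral_power_series:
  fixes g w :: "'a \<Rightarrow> real" and c :: "nat \<Rightarrow> real"
    and s :: complex
  assumes [measurable]: "g \<in> borel_measurable M" "w \<in> borel_measurable M"
    and c: "\<And>m. \<bar>c m\<bar> \<le> 1 / fact m"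
    and int: "integrable M (\<lambda>x. exp (R * \<bar>g x\<bar>) * \<bar>w x\<bar>)" and s: "norm s \<le> R"
  shows "(\<lambda>m. of_real (c m * (\<integral>x. g x ^ m * w x \<partial>M)) * s ^ m) sums
           (\<integral>x. (\<Sum>m. of_real (c m) * (s * of_real (g x)) ^ m) * of_real (w x) \<partial>M)"
proof -
  define f where "f = (\<lambda>m x. of_real (c m) * (s * of_real (g x)) ^ m * (of_real (w x) :: complex))"
  have [measurable]: "f m \<in> borel_measurable M" for m
    unfolding f_def by measurable
  have "0 \<le> R" using norm_ge_zero s by (rule order_trans)
  have f_le: "norm (f m x) \<le> (R * \<bar>g x\<bar>) ^ m /\<^sub>R fact m * \<bar>w x\<bar>" for m x
  proof -
    have "norm (f m x) = \<bar>c m\<bar> * (norm s * \<bar>g x\<bar>) ^ m * \<bar>w x\<bar>"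
      by (simp add: f_def norm_mult norm_power)
    also have "\<dots> \<le> 1 / fact m * (R * \<bar>g x\<bar>) ^ m * \<bar>w x\<bar>"
      using s \<open>0 \<le> R\<close> by (intro mult_mono power_mono c) auto
    finally show ?thesis by (simp add: divide_simps)
  qed
  have exp_sums: "(\<lambda>m. (R * \<bar>g x\<bar>) ^ m /\<^sub>R fact m * \<bar>w x\<bar>) sums (exp (R * \<bar>g x\<bar>) * \<bar>w x\<bar>)" for x
    by (intro sums_mult2 exp_converges)
  have summable_f: "summable (\<lambda>m. norm (f m x))" for x
    by (rule summable_comparison_test'[OF sums_summable[OF exp_sums]]) (use f_le in auto)
  have sum_le: "(\<Sum>m<n. norm (f m x)) \<le> exp (R * \<bar>g x\<bar>) * \<bar>w x\<bar>" for n x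
  proof -
    have "(\<Sum>m<n. norm (f m x)) \<le> (\<Sum>m<n. (R * \<bar>g x\<bar>) ^ m /\<^sub>R fact m * \<bar>w x\<bar>)"
      by (intro sum_mono f_le)
    also have "\<dots> \<le> (\<Sum>m. (R * \<bar>g x\<bar>) ^ m /\<^sub>R fact m * \<bar>w x\<bar>)"
      using \<open>0 \<le> R\<close> by (intro sum_le_suminf sums_summable[OF exp_sums]) auto
    also have "\<dots> = exp (R * \<bar>g x\<bar>) * \<bar>w x\<bar>"
      by (rule sums_unique[OF exp_sums, symmetric])
    finally show ?thesis .
  qed
  have int_f: "integrable M (f m)" for m
  proof (rule Bochner_Integration.integrable_bound[OF int])
    have "norm (f m x) \<le> norm (exp (R * \<bar>g x\<bar>) * \<bar>w x\<bar>)" for x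
      using sum_le[of x "Suc m"] sum_nonneg[of "{..<m}" "\<lambda>m. norm (f m x)"] by simp
    then show "AE x in M. norm (f m x) \<le> norm (exp (R * \<bar>g x\<bar>) * \<bar>w x\<bar>)" by simp
  qed measurable
  have "summable (\<lambda>m. \<integral>x. norm (f m x) \<partial>M)"
  proof (rule summableI_nonneg_bounded)
    fix n
    have "(\<Sum>m<n. \<integral>x. norm (f m x) \<partial>M) = (\<integral>x. (\<Sum>m<n. norm (f m x)) \<partial>M)"
      by (rule Bochner_Integration.integral_sum[symmetric]) (use int_f in auto)
    also have "\<dots> \<le> (\<integral>x. exp (R * \<bar>g x\<bar>) * \<bar>w x\<bar> \<partial>M)"
      by (intro integral_mono int sum_le Bochner_Integration.integrable_sum integrable_norm int_f)
    finally show "(\<Sum>m<n. \<integral>x. norm (f m x) \<partial>M) \<le> (\<integral>x. exp (R * \<bar>g x\<bar>) * \<bar>w x\<bar> \<partial>M)" .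
  qed simp
  then have "(\<lambda>m. \<integral>x. f m x \<partial>M) sums (\<integral>x. (\<Sum>m. f m x) \<partial>M)"
    using summable_f by (intro sums_integral int_f) auto
  moreover have "(\<integral>x. f m x \<partial>M) = of_real (c m * (\<integral>x. g x ^ m * w x \<partial>M)) * s ^ m" for m
  proof -
    have "f m = (\<lambda>x. (of_real (c m) * s ^ m) * of_real (g x ^ m * w x))"
      by (simp add: f_def power_mult_distrib mult_ac)
    then show ?thesis
      by (simp only: integral_mult_right_zero integral_complex_of_real) simp
  qed
  moreover have "(\<Sum>m. f m x) = (\<Sum>m. of_real (c m) * (s * of_real (g x)) ^ m) * of_real (w x)" for x
  \<comment> \<open>Summability is known only with the weight \<open>w x\<close> inside; for
    \<open>w x \<noteq> 0\<close> it can be cancelled, and otherwise both sides vanish.\<close>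
  proof (cases "w x = 0")
    case False
    have "summable (\<lambda>m. of_real (w x) * (of_real (c m) * (s * of_real (g x)) ^ m) :: complex)"
      using summable_norm_cancel[OF summable_f[of x]] by (simp only: f_def mult.commute)
    then have "summable (\<lambda>m. of_real (c m) * (s * of_real (g x)) ^ m :: complex)"
      using False by (simp only: summable_cmult_iff of_real_eq_0_iff simp_thms)
    then show ?thesis unfolding f_def by (rule suminf_mult2[symmetric])
  qed (simp add: f_def)
  ultimately show ?thesis by simp
qed

text \<open>Euler's integral for \<open>a = 1\<close> is moved from \<open>lebesgue\<close> to
  \<open>lborel\<close> and then rescaled by t -> a t.\<close>

lemma has_bochner_integral_Gamma:
  fixes s :: complex and a :: real
  assumes s: "Re s > 0" and a: "a > 0"
  shows "has_bochner_integral lborel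
           (\<lambda>t. indicator {0<..} t *\<^sub>R (of_real t powr (s - 1) * of_real (exp (- (a * t)))))
           (Gamma s / of_real a powr s)"
proof -
  let ?f = "\<lambda>t::real. indicator {0<..} t *\<^sub>R (of_real t powr (s - 1) / of_real (exp t) :: complex)"
  have abs_int: "(\<lambda>t. complex_of_real t powr (s - 1) / of_real (exp t)) absolutely_integrable_on {0<..}"
    using s by (rule absolutely_integrable_Gamma_integral')
  then have "integrable lborel ?f"
    by (subst integrable_completion[symmetric]) (simp_all add: set_integrable_def)
  moreover have "integral\<^sup>L lborel ?f = Gamma s"
  proof -
    have "integral\<^sup>L lborel ?f = integral\<^sup>L lebesgue ?f"
      by (rule integral_completion[symmetric]) simp
    also have "\<dots> = Gamma s"
      using set_lebesgue_integral_eq_integral(2)[OF abs_int] Gamma_integral_complex'[OF s]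
      by (simp add: set_lebesgue_integral_def integral_unique)
    finally show ?thesis .
  qed
  ultimately have "has_bochner_integral lborel ?f (Gamma s)"
    by (simp add: has_bochner_integral_iff)
  then have "has_bochner_integral lborel (\<lambda>t. ?f (0 + a * t)) (Gamma s /\<^sub>R \<bar>a\<bar>)"
    using a by (subst (asm) lborel_has_bochner_integral_real_affine_iff[of a _ _ 0]) auto
  \<comment> \<open>The rescaled integrand carries (a t)^(s-1); the factor a^(1-s) restores
    t^(s-1).\<close>
  then have *: "has_bochner_integral lborel (\<lambda>t. ?f (0 + a * t) * of_real a powr (1 - s))
                (Gamma s /\<^sub>R \<bar>a\<bar> * of_real a powr (1 - s))"
    by (rule has_bochner_integral_mult_left)
  have "?f (0 + a * t) * of_real a powr (1 - s) =
      indicator {0<..} t *\<^sub>R (of_real t powr (s - 1) * of_real (exp (- (a * t))))" for t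
  proof (cases "t > 0")
    case True
    have "complex_of_real a powr (s - 1) * of_real a powr (1 - s) = 1"
      using a by (simp flip: powr_add)
    then show ?thesis
      using True a by (simp add: powr_times_real exp_minus field_simps)
  next
    case False
    then show ?thesis using a by (simp add: indicator_def zero_less_mult_iff)
  qed
  moreover have "Gamma s /\<^sub>R \<bar>a\<bar> * of_real a powr (1 - s) = Gamma s / of_real a powr s"
    using a by (simp add: powr_diff scaleR_conv_of_real field_simps)
  ultimately show ?thesis using * by simp
qed

lemma has_bochner_integral_power_exp:
  fixes a :: real
  assumes a: "a > 0"
  shows "has_bochner_integral lborel (\<lambda>t. indicator {0<..} t * (t ^ n * exp (- (a * t)))) (fact n / a ^ Suc n)"
proof -
  have *: "has_bochner_integral lborel
      (\<lambda>t. Re (indicator {0<..} t *\<^sub>R (of_real t powr (of_nat (Suc n) - 1) * of_real (exp (- (a * t))))))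
      (Re (Gamma (of_nat (Suc n)) / of_real a powr of_nat (Suc n)))"
    by (intro has_bochner_integral_bounded_linear[OF bounded_linear_Re] has_bochner_integral_Gamma)
       (use a in auto)
  have eq1: "Re (indicator {0<..} t *\<^sub>R (of_real t powr (of_nat (Suc n) - 1) * of_real (exp (- (a * t))))) =
      indicator {0<..} t * (t ^ n * exp (- (a * t)))" for t :: real
    by (auto simp: indicator_def powr_nat' simp flip: of_real_power of_real_mult)
  have eq2: "Gamma (of_nat (Suc n)) / of_real a powr of_nat (Suc n) =
      complex_of_real (fact n / a ^ Suc n)"
    using a Gamma_fact[of n, where ?'a = complex] powr_nat'[of "complex_of_real a" "Suc n"] by (simp add: add.commute)
  show ?thesis using * unfolding eq1 eq2 Re_complex_of_real .
qed

section \<open>The cumulants as integrals\<close>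

lemma exp_minus_one_sums: "(\<lambda>m. z ^ Suc m / fact (Suc m)) sums (exp z - 1 :: complex)"
proof -
  have "(\<lambda>m. z ^ m / fact m) sums exp z"
    using exp_converges[of z] by (simp add: scaleR_conv_of_real divide_inverse mult.commute)
  then show ?thesis
    by (subst sums_Suc_iff) simp
qed

text \<open>Since 1 - e^(-t) = (1 - e^(-t/2))(1 + e^(-t/2)), the density in the exponent is
  \<open>v t / t\<close>. The exponent \<open>L\<close> has Taylor series \<open>F\<close> at 0, and
  near 0 it coincides with the principal logarithm of the Mellin transform, so the derivatives are
  read off from \<open>F\<close>.\<close>

lemma neg_log_cumulant_eq_integral:
  assumes \<delta>: "0 < \<delta>" and M: "barnes_beta_22 \<delta> M" and n: "n \<ge> 1"
  shows "neg_log_cumulant M n = complex_of_real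
           (LINT t:{0<..}|lborel. t ^ (n - 1) * (exp (- (\<delta> * t)) / (1 + exp (- t / 2))\<^sup>2))"
proof -
  define v where "v = (\<lambda>t::real. exp (- (\<delta> * t)) / (1 + exp (- t / 2))\<^sup>2)"
  define w where "w = (\<lambda>t::real. indicator {0<..} t * v t)"
  define K where "K = (\<lambda>m. \<integral>t. t ^ m * w t \<partial>lborel)"
  define L where "L = (\<lambda>q. LINT t:{0<..}|lborel. (exp (- (of_real t * q)) - 1) *
      complex_of_real (exp (- (\<delta> * t)) * ((1 - exp (- t / 2))\<^sup>2 / (1 - exp (- t))\<^sup>2) / t))"
  \<comment> \<open>The coefficient of q^m involves the moment of order m - 1, because dt/t removes
    one power of t.\<close>
  define F where "F = Abs_fps (\<lambda>m. if m = 0 then 0 else (- 1) ^ m * complex_of_real (K (m - 1)) / fact m)"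
  have v_pos: "0 < v t" for t
    unfolding v_def by (intro divide_pos_pos zero_less_power add_pos_pos) auto
  have v_le: "v t \<le> exp (- (\<delta> * t))" for t
  proof -
    have "1 \<le> (1 + exp (- t / 2))\<^sup>2" by (rule one_le_power) simp
    then show ?thesis by (simp add: v_def divide_le_eq mult_le_cancel_left1)
  qed
  have [measurable]: "v \<in> borel_measurable borel" "w \<in> borel_measurable borel"
    unfolding w_def v_def by measurable
  \<comment> \<open>\<open>v\<close> decays like exp(-\<delta> t); half of this rate is spent on the
    factor exp(\<delta> t / 2), the other half keeps the product integrable.\<close>
  have int: "integrable lborel (\<lambda>t. exp (\<delta> / 2 * \<bar>t\<bar>) * \<bar>w t\<bar>)"
  proof (rule Bochner_Integration.integrable_bound)
    show "integrable lborel (\<lambda>t::real. indicator {0<..} t * (t ^ 0 * exp (- (\<delta> / 2 * t))))"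
      using has_bochner_integral_power_exp[of "\<delta> / 2" 0] \<delta> by (simp add: has_bochner_integral_iff)
    have "exp (\<delta> / 2 * t) * v t \<le> exp (- (\<delta> / 2 * t))" if "t > 0" for t
    proof -
      have "exp (\<delta> / 2 * t) * v t \<le> exp (\<delta> / 2 * t) * exp (- (\<delta> * t))"
        by (intro mult_left_mono v_le) simp
      also have "\<dots> = exp (- (\<delta> / 2 * t))" by (simp flip: exp_add)
      finally show ?thesis .
    qed
    then show "AE t in lborel. norm (exp (\<delta> / 2 * \<bar>t\<bar>) * \<bar>w t\<bar>) \<le>
        norm (indicator {0<..} t * (t ^ 0 * exp (- (\<delta> / 2 * t))))"
      using v_pos by (intro AE_I2) (auto simp: w_def indicator_def abs_of_pos)
  qed measurable
  \<comment> \<open>With z = -q t, e^z - 1 is z times the sum of z^m / (m+1)!. The t in z cancels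
    the singular 1/t, which leaves a power series with the integrable weight
    \<open>w\<close>.\<close>
  have integrand: "- q * ((\<Sum>m. of_real (1 / fact (Suc m)) * (- q * of_real t) ^ m) * of_real (w t)) =
      indicator {0<..} t *\<^sub>R ((exp (- (of_real t * q)) - 1) *
        complex_of_real (exp (- (\<delta> * t)) * ((1 - exp (- t / 2))\<^sup>2 / (1 - exp (- t))\<^sup>2) / t))" for q t
  proof (cases "t > 0")
    case True
    define z where "z = - q * of_real t"
    have sum: "z * (\<Sum>m. z ^ m / fact (Suc m)) = exp z - 1"
    proof (cases "z = 0")
      case False
      have *: "(\<lambda>m. z * (z ^ m / fact (Suc m))) sums (exp z - 1)"
        using exp_minus_one_sums[of z] by simp
      with False have "summable (\<lambda>m. z ^ m / fact (Suc m))"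
        by (metis sums_summable summable_cmult_iff)
      then show ?thesis
        using sums_unique[OF *] by (simp only: suminf_mult)
    qed simp
    have "1 - exp (- t) = (1 - exp (- t / 2)) * (1 + exp (- t / 2))"
      by (simp add: algebra_simps flip: exp_add)
    moreover have "1 - exp (- t / 2) \<noteq> 0" using True by simp
    ultimately have v: "exp (- (\<delta> * t)) * ((1 - exp (- t / 2))\<^sup>2 / (1 - exp (- t))\<^sup>2) / t = v t / t"
      by (simp add: v_def power_mult_distrib)
    have "- q * ((\<Sum>m. of_real (1 / fact (Suc m)) * (- q * of_real t) ^ m) * of_real (w t)) =
        z * (\<Sum>m. z ^ m / fact (Suc m)) * of_real (v t / t)"
      using True by (simp add: w_def z_def mult_ac)
    also have "\<dots> = (exp z - 1) * of_real (v t / t)" by (simp only: sum)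
    also have "exp z = exp (- (of_real t * q))" by (simp add: z_def mult.commute)
    finally show ?thesis using True by (simp only: v) simp
  qed (simp add: w_def)
  have L_sums: "(\<lambda>m. fps_nth F m * q ^ m) sums L q" if q: "norm q \<le> \<delta> / 2" for q
  proof -
    have "(\<lambda>m. of_real (1 / fact (Suc m) * (\<integral>t. t ^ m * w t \<partial>lborel)) * (- q) ^ m) sums
        (\<integral>t. (\<Sum>m. of_real (1 / fact (Suc m)) * (- q * of_real t) ^ m) * of_real (w t) \<partial>lborel)"
      by (rule integral_power_series[where R = "\<delta> / 2"])
         (use int q in \<open>auto simp: divide_simps intro!: fact_mono mult_mono simp del: fact_Suc\<close>)
    then have "(\<lambda>m. - q * (of_real (1 / fact (Suc m) * K m) * (- q) ^ m)) sums
        (- q * (\<integral>t. (\<Sum>m. of_real (1 / fact (Suc m)) * (- q * of_real t) ^ m) * of_real (w t) \<partial>lborel))"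
      unfolding K_def by (rule sums_mult)
    also have "- q * (\<integral>t. (\<Sum>m. of_real (1 / fact (Suc m)) * (- q * of_real t) ^ m) * of_real (w t) \<partial>lborel) = L q"
      unfolding L_def set_lebesgue_integral_def
      by (simp only: integrand flip: integral_mult_right_zero)
    also have "(\<lambda>m. - q * (of_real (1 / fact (Suc m) * K m) * (- q) ^ m)) =
        (\<lambda>m. fps_nth F (Suc m) * q ^ Suc m)"
      by (rule ext) (simp add: F_def power_minus' field_simps)
    finally show ?thesis
      by (subst (asm) sums_Suc_iff) (simp add: F_def)
  qed
  have "eventually (\<lambda>q. q \<in> cball (0::complex) (\<delta> / 2)) (nhds 0)"
    using \<delta> by (intro eventually_nhds_in_nhd) simp
  then have L: "L has_fps_expansion F"
    by (intro has_fps_expansionI) (auto elim!: eventually_mono intro!: L_sums)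
  \<comment> \<open>Closeness of \<open>L\<close> to 0 keeps its imaginary part strictly between -pi
    and pi, where \<open>Ln\<close> inverts \<open>exp\<close>.\<close>
  have "(L \<longlongrightarrow> 0) (nhds 0)"
    using has_fps_expansion_imp_tendsto_0[OF L] by (simp add: F_def)
  then have "eventually (\<lambda>q. dist (L q) 0 < pi) (nhds 0)"
    by (rule tendstoD) simp
  moreover have "eventually (\<lambda>q. q \<in> ball (0::complex) \<delta>) (nhds 0)"
    using \<delta> by (intro eventually_nhds_in_open) auto
  ultimately have "eventually (\<lambda>q. Ln (mellin M q) = L q) (nhds 0)"
  proof eventually_elim
    case (elim q)
    have "Re q > - \<delta>" using elim(2) abs_Re_le_cmod[of q] by simp
    then have "mellin M q = exp (L q)"
      using M unfolding barnes_beta_22_def L_def by blast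
    moreover have "\<bar>Im (L q)\<bar> < pi" using elim(1) abs_Im_le_cmod[of "L q"] by simp
    ultimately show ?case by (simp add: Ln_exp)
  qed
  then have "(deriv ^^ n) (\<lambda>q. Ln (mellin M q)) 0 = (deriv ^^ n) L 0"
    by (rule higher_deriv_cong_ev) simp
  also have "\<dots> = fact n * fps_nth F n"
    by (subst fps_nth_fps_expansion[OF L]) simp
  also have "\<dots> = (- 1) ^ n * K (n - 1)"
    using n by (simp add: F_def)
  finally have "neg_log_cumulant M n = K (n - 1)"
    by (simp add: neg_log_cumulant_def flip: mult.assoc power_mult_distrib)
  then show ?thesis
    by (simp add: K_def w_def v_def set_lebesgue_integral_def mult.left_commute)
qed

section \<open>Gaussian moments on the half-line\<close>

lemma Gamma_of_nat_plus_half: "Gamma (of_nat k + 1 / 2 :: real) = sqrt pi * (fact (2 * k) / (2 ^ (2 * k) * fact k))"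
proof (induction k)
  case 0
  then show ?case by (simp add: Gamma_one_half_real)
next
  case (Suc k)
  have "real k + 1 / 2 \<notin> \<int>\<^sub>\<le>\<^sub>0"
    by (auto elim!: nonpos_Ints_cases)
  then have "Gamma (of_nat (Suc k) + 1 / 2 :: real) = (real k + 1 / 2) * Gamma (real k + 1 / 2)"
    using Gamma_plus1[of "real k + 1 / 2"] by (simp add: add_ac)
  also have "\<dots> = (real k + 1 / 2) * (sqrt pi * (fact (2 * k) / (2 ^ (2 * k) * fact k)))"
    by (simp only: Suc.IH)
  also have "\<dots> = sqrt pi * ((2 * (real k + 1)) * (2 * real k + 1) * fact (2 * k) /
      (4 * 2 ^ (2 * k) * ((real k + 1) * fact k)))"
    by (simp add: divide_simps) (simp add: algebra_simps)
  also have "(2 * (real k + 1)) * (2 * real k + 1) * fact (2 * k) = fact (2 * Suc k)"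
    by (simp add: algebra_simps)
  finally show ?case by (simp add: add.commute)
qed

text \<open>Even and odd moments of exp(-t^2) have separate closed forms; half-integer and integer
  values of Gamma unify them. The substitution t -> sqrt a t then brings in \<open>a\<close>, and
  passing from the closed to the open half-line drops a null set.\<close>

lemma has_bochner_integral_power_gaussian:
  fixes a :: real
  assumes a: "a > 0"
  shows "has_bochner_integral lborel (\<lambda>t. indicator {0<..} t * (t ^ n * exp (- (a * t\<^sup>2))))
           (Gamma (real (Suc n) / 2) / 2 * a powr - (real (Suc n) / 2))"
proof -
  let ?h = "\<lambda>t::real. indicator {0..} t * (t ^ n * exp (- t\<^sup>2))"
  have "has_bochner_integral lborel ?h (Gamma (real (Suc n) / 2) / 2)"
  proof (cases "even n")
    case True
    then obtain k where k: "n = 2 * k" by (elim evenE)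
    have "Gamma (real (Suc n) / 2) / 2 = (sqrt pi / 2) * (fact (2 * k) / (2 ^ (2 * k) * fact k))"
      using Gamma_of_nat_plus_half[of k] by (simp add: k add_divide_distrib add.commute)
    then show ?thesis
      using gaussian_moment_even_pos[of k] by (simp add: k mult.commute)
  next
    case False
    then obtain k where k: "n = 2 * k + 1" by (elim oddE)
    have "Gamma (real (Suc n) / 2) = fact k"
      using Gamma_fact[of k, where ?'a = real] by (simp add: k add_divide_distrib add.commute)
    then show ?thesis
      using gaussian_moment_odd_pos[of k] by (simp add: k mult.commute)
  qed
  then have "has_bochner_integral lborel (\<lambda>t. ?h (0 + sqrt a * t)) (Gamma (real (Suc n) / 2) / 2 /\<^sub>R \<bar>sqrt a\<bar>)"
    using a by (subst (asm) lborel_has_bochner_integral_real_affine_iff[of "sqrt a" _ _ 0]) auto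
  then have scaled: "has_bochner_integral lborel (\<lambda>t. ?h (0 + sqrt a * t) * (1 / sqrt a ^ n))
      (Gamma (real (Suc n) / 2) / 2 /\<^sub>R \<bar>sqrt a\<bar> * (1 / sqrt a ^ n))"
    by (rule has_bochner_integral_mult_left)
  have eq1: "Gamma (real (Suc n) / 2) / 2 /\<^sub>R \<bar>sqrt a\<bar> * (1 / sqrt a ^ n) =
      Gamma (real (Suc n) / 2) / 2 * a powr - (real (Suc n) / 2)"
  proof -
    have "a powr (real (Suc n) / 2) = (a powr (1 / 2)) powr real (Suc n)"
      by (simp add: powr_powr)
    also have "\<dots> = sqrt a ^ Suc n"
      using a by (subst powr_realpow) (simp_all add: powr_half_sqrt)
    finally show ?thesis
      using a by (simp add: powr_minus field_simps)
  qed
  have eq2: "?h (0 + sqrt a * t) * (1 / sqrt a ^ n) = indicator {0..} t * (t ^ n * exp (- (a * t\<^sup>2)))" for t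
    using a by (simp add: indicator_def zero_le_mult_iff power_mult_distrib)
  have *: "has_bochner_integral lborel (\<lambda>t. indicator {0..} t * (t ^ n * exp (- (a * t\<^sup>2))))
      (Gamma (real (Suc n) / 2) / 2 * a powr - (real (Suc n) / 2))"
    using scaled unfolding eq1 eq2 .
  have "AE t in lborel. indicator {0..} t * (t ^ n * exp (- (a * t\<^sup>2))) =
      indicator {0<..} t * (t ^ n * exp (- (a * t\<^sup>2)))"
    using AE_lborel_singleton[of 0] by eventually_elim (auto simp: indicator_def)
  then show ?thesis
    using * by (subst (asm) has_bochner_integral_cong_AE) simp_all
qed

section \<open>The squared hyperbolic secant and the moments of \<open>C\<close>\<close>

lemma sech_sq_le:
  fixes t :: real
  shows "(1 / cosh (t / 4))\<^sup>2 / 4 \<le> exp (- (t / 2))"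
proof -
  have "exp (t / 4) \<le> 2 * cosh (t / 4)" by (simp add: cosh_def)
  then have "exp (t / 4) ^ 2 \<le> (2 * cosh (t / 4)) ^ 2" by (intro power_mono) auto
  then have "exp (t / 2) \<le> 4 * (cosh (t / 4))\<^sup>2"
    by (simp add: power_mult_distrib flip: exp_of_nat_mult)
  then show ?thesis by (simp add: field_simps exp_minus power2_eq_square)
qed

text \<open>The weight decays at rate 1/2, so a growth rate \<open>R\<close> below 1/2 leaves
  exponential decay. For R = \<bar>\<delta> - 1/2\<bar> this is the range 0 < \<delta> < 1.\<close>

lemma integrable_exp_power_sech_sq:
  fixes R :: real
  assumes R: "R < 1 / 2"
  shows "integrable lborel (\<lambda>t. exp (R * \<bar>t\<bar>) * \<bar>indicator {0<..} t * (t ^ n * ((1 / cosh (t / 4))\<^sup>2 / 4))\<bar>)"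
proof (rule Bochner_Integration.integrable_bound)
  show "integrable lborel (\<lambda>t. indicator {0<..} t * (t ^ n * exp (- ((1 / 2 - R) * t))))"
    using has_bochner_integral_power_exp[of "1 / 2 - R" n] R by (simp add: has_bochner_integral_iff)
  have "exp (R * t) * (t ^ n * ((1 / cosh (t / 4))\<^sup>2 / 4)) \<le> t ^ n * exp (- ((1 / 2 - R) * t))" if "t > 0" for t
  proof -
    have "exp (R * t) * (t ^ n * ((1 / cosh (t / 4))\<^sup>2 / 4)) \<le> exp (R * t) * (t ^ n * exp (- (t / 2)))"
      using that by (intro mult_left_mono sech_sq_le) auto
    also have "\<dots> = t ^ n * (exp (R * t) * exp (- (t / 2)))" by simp
    also have "exp (R * t) * exp (- (t / 2)) = exp (- ((1 / 2 - R) * t))"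
      unfolding exp_add[symmetric] by (simp add: algebra_simps)
    finally show ?thesis .
  qed
  then show "AE t in lborel.
      norm (exp (R * \<bar>t\<bar>) * \<bar>indicator {0<..} t * (t ^ n * ((1 / cosh (t / 4))\<^sup>2 / 4))\<bar>) \<le>
      norm (indicator {0<..} t * (t ^ n * exp (- ((1 / 2 - R) * t))))"
    by (intro AE_I2) (auto simp: indicator_def abs_mult)
qed (simp add: cosh_def)

text \<open>Taking q = t^2/32 in the Laplace transform gives sqrt(2q) = t/4. After exchanging the
  order of integration, the inner integral is a Gaussian moment with a = C/32. Everything is
  nonnegative, so the exchange is made in \<open>ennreal\<close>, and finiteness of the negative
  moment of \<open>C\<close> follows from finiteness of the left side.\<close>

lemma integral_power_sech_sq_eq_moment:
  assumes C: "C2_variable N C"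
  shows "(\<integral>t. indicator {0<..} t * (t ^ n * (1 / cosh (t / 4))\<^sup>2) \<partial>lborel) =
    1 / 2 * 32 powr (real (Suc n) / 2) * Gamma (real (Suc n) / 2) * (\<integral>\<omega>. C \<omega> powr - (real (Suc n) / 2) \<partial>N)"
    (is "?I = ?c * ?g * ?E")
proof -
  interpret N: prob_space N using C by (simp add: C2_variable_def)
  have [measurable]: "C \<in> borel_measurable N" and C_pos: "AE \<omega> in N. 0 < C \<omega>"
    and laplace: "\<And>q. q > 0 \<Longrightarrow> (\<integral>\<omega>. exp (- (q * C \<omega>)) \<partial>N) = (1 / cosh (sqrt (2 * q)))\<^sup>2"
    using C by (auto simp: C2_variable_def)
  interpret P: pair_sigma_finite lborel N ..
  have [measurable]: "(\<lambda>t::real. cosh (t / 4)) \<in> borel_measurable borel"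
    unfolding cosh_def by measurable
  have sech: "(\<integral>\<^sup>+\<omega>. ennreal (exp (- (t\<^sup>2 / 32 * C \<omega>))) \<partial>N) = ennreal ((1 / cosh (t / 4))\<^sup>2)" if "t > 0" for t
  proof -
    have "integrable N (\<lambda>\<omega>. exp (- (t\<^sup>2 / 32 * C \<omega>)))"
      using C_pos by (intro N.integrable_const_bound[where B = 1]) (auto elim!: eventually_mono)
    moreover have "sqrt (2 * (t\<^sup>2 / 32)) = t / 4"
      using that by (intro real_sqrt_unique) (simp_all add: power2_eq_square)
    ultimately show ?thesis
      using laplace[of "t\<^sup>2 / 32"] that by (subst nn_integral_eq_integral) auto
  qed
  have int_I: "integrable lborel (\<lambda>t::real. indicator {0<..} t * (t ^ n * (1 / cosh (t / 4))\<^sup>2))"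
  proof -
    have "integrable lborel (\<lambda>t::real. 4 * (exp (0 * \<bar>t\<bar>) * \<bar>indicator {0<..} t * (t ^ n * ((1 / cosh (t / 4))\<^sup>2 / 4))\<bar>))"
      by (intro integrable_mult_right impI integrable_exp_power_sech_sq) simp
    also have "(\<lambda>t. 4 * (exp (0 * \<bar>t\<bar>) * \<bar>indicator {0<..} t * (t ^ n * ((1 / cosh (t / 4))\<^sup>2 / 4))\<bar>)) =
        (\<lambda>t::real. indicator {0<..} t * (t ^ n * (1 / cosh (t / 4))\<^sup>2))"
      by (auto simp: indicator_def abs_mult)
    finally show ?thesis .
  qed
  have "ennreal ?I = (\<integral>\<^sup>+t. ennreal (indicator {0<..} t * (t ^ n * (1 / cosh (t / 4))\<^sup>2)) \<partial>lborel)"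
    by (rule nn_integral_eq_integral[symmetric, OF int_I]) (auto simp: indicator_def)
  also have "\<dots> = (\<integral>\<^sup>+t. (\<integral>\<^sup>+\<omega>. ennreal (indicator {0<..} t * (t ^ n * exp (- (t\<^sup>2 / 32 * C \<omega>)))) \<partial>N) \<partial>lborel)"
  proof (intro nn_integral_cong)
    fix t :: real
    show "ennreal (indicator {0<..} t * (t ^ n * (1 / cosh (t / 4))\<^sup>2)) =
        (\<integral>\<^sup>+\<omega>. ennreal (indicator {0<..} t * (t ^ n * exp (- (t\<^sup>2 / 32 * C \<omega>)))) \<partial>N)"
    proof (cases "t > 0")
      case True
      have "(\<integral>\<^sup>+\<omega>. ennreal (t ^ n * exp (- (t\<^sup>2 / 32 * C \<omega>))) \<partial>N) =
          ennreal (t ^ n) * ennreal ((1 / cosh (t / 4))\<^sup>2)"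
        using sech[OF True] True by (simp add: ennreal_mult' nn_integral_cmult del: times_divide_eq_left)
      then show ?thesis using True by (simp add: ennreal_mult')
    qed simp
  qed
  also have "\<dots> = (\<integral>\<^sup>+\<omega>. (\<integral>\<^sup>+t. ennreal (indicator {0<..} t * (t ^ n * exp (- (t\<^sup>2 / 32 * C \<omega>)))) \<partial>lborel) \<partial>N)"
    by (rule P.Fubini'[symmetric]) measurable
  also have "\<dots> = (\<integral>\<^sup>+\<omega>. ennreal (?c * ?g * C \<omega> powr - (real (Suc n) / 2)) \<partial>N)"
  proof (rule nn_integral_cong_AE, use C_pos in eventually_elim)
    fix \<omega> assume "C \<omega> > 0"
    then have "has_bochner_integral lborel (\<lambda>t. indicator {0<..} t * (t ^ n * exp (- (C \<omega> / 32 * t\<^sup>2))))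
        (?g / 2 * (C \<omega> / 32) powr - (real (Suc n) / 2))"
      by (intro has_bochner_integral_power_gaussian) simp
    moreover have "?g / 2 * (C \<omega> / 32) powr - (real (Suc n) / 2) = ?c * ?g * C \<omega> powr - (real (Suc n) / 2)"
      using \<open>C \<omega> > 0\<close> by (simp add: powr_divide powr_minus field_simps)
    ultimately show "(\<integral>\<^sup>+t. ennreal (indicator {0<..} t * (t ^ n * exp (- (t\<^sup>2 / 32 * C \<omega>)))) \<partial>lborel) =
        ennreal (?c * ?g * C \<omega> powr - (real (Suc n) / 2))"
      by (subst nn_integral_eq_integral) (auto simp: has_bochner_integral_iff indicator_def mult.commute)
  qed
  finally have "(\<integral>\<^sup>+\<omega>. ennreal (?c * ?g * C \<omega> powr - (real (Suc n) / 2)) \<partial>N) = ennreal ?I" ..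
  \<comment> \<open>The value \<open>ennreal ?I\<close> is finite, hence the right-hand integrand is
    integrable and the equation descends to real integrals.\<close>
  then have "(\<integral>\<omega>. ?c * ?g * C \<omega> powr - (real (Suc n) / 2) \<partial>N) = ?I"
    by (subst (asm) nn_integral_eq_integrable)
       (auto simp: indicator_def intro!: integral_nonneg_AE AE_I2 mult_nonneg_nonneg Gamma_real_nonneg)
  then show ?thesis by simp
qed

text \<open>Pulling e^(-t/4) out of 1 + e^(-t/2) leaves 2 cosh(t/4). The square of that factor
  shifts the exponent by 1/2, which is why the series runs in powers of \<delta> - 1/2.\<close>

lemma sech_sq_conv_exp:
  fixes t :: real
  shows "exp (- (\<delta> * t)) / (1 + exp (- t / 2))\<^sup>2 = exp (- ((\<delta> - 1 / 2) * t)) * ((1 / cosh (t / 4))\<^sup>2 / 4)"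
proof -
  have "1 + exp (- t / 2) = exp (- t / 4) * (2 * cosh (t / 4))"
    by (simp add: cosh_def algebra_simps flip: exp_add)
  then have "(1 + exp (- t / 2))\<^sup>2 = exp (- t / 4) ^ 2 * (4 * (cosh (t / 4))\<^sup>2)"
    by (simp add: power_mult_distrib)
  also have "exp (- t / 4) ^ 2 = exp (- t / 2)"
    by (simp flip: exp_of_nat_mult)
  finally have "exp (- (\<delta> * t)) / (1 + exp (- t / 2))\<^sup>2 =
      exp (- (\<delta> * t)) / exp (- t / 2) * (1 / (4 * (cosh (t / 4))\<^sup>2))"
    by simp
  also have "exp (- (\<delta> * t)) / exp (- t / 2) = exp (- ((\<delta> - 1 / 2) * t))"
    by (simp add: algebra_simps flip: exp_diff)
  finally show ?thesis by (simp add: power_divide)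
qed

text \<open>Expanding exp(-(\<delta> - 1/2) t) produces moments of order m + n - 1 against sech^2.
  The constant 1/8 is the 1/4 in the weight times the 1/2 of the Gaussian moments.\<close>

lemma cumulant_integral_sums:
  assumes C: "C2_variable N C" and \<delta>: "0 < \<delta>" "\<delta> < 1" and n: "n \<ge> 1"
  shows "(\<lambda>m. 1 / 8 * ((- (\<delta> - 1 / 2)) ^ m / fact m * 32 powr (real (m + n) / 2) *
            Gamma (real (m + n) / 2) * (LINT \<omega>|N. C \<omega> powr (- (real (m + n) / 2))))) sums
         (LINT t:{0<..}|lborel. t ^ (n - 1) * (exp (- (\<delta> * t)) / (1 + exp (- t / 2))\<^sup>2))"
proof -
  define w where "w = (\<lambda>t::real. indicator {0<..} t * (t ^ (n - 1) * ((1 / cosh (t / 4))\<^sup>2 / 4)))"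
  define s where "s = - (\<delta> - 1 / 2)"
  have [measurable]: "w \<in> borel_measurable lborel"
    unfolding w_def cosh_def by measurable
  have "(\<lambda>m. of_real (1 / fact m * (\<integral>t. t ^ m * w t \<partial>lborel)) * of_real s ^ m) sums
      (\<integral>t. (\<Sum>m. of_real (1 / fact m) * (of_real s * of_real t) ^ m) * complex_of_real (w t) \<partial>lborel)"
  proof (rule integral_power_series)
    show "integrable lborel (\<lambda>t. exp (\<bar>s\<bar> * \<bar>t\<bar>) * \<bar>w t\<bar>)"
      unfolding w_def using \<delta> by (intro integrable_exp_power_sech_sq) (auto simp: s_def abs_if)
  qed auto
  moreover have "(\<Sum>m. of_real (1 / fact m) * (of_real s * of_real t) ^ m) = complex_of_real (exp (s * t))" for t
  proof -
    have "(\<lambda>m. complex_of_real (1 / fact m) * (of_real s * of_real t) ^ m) sums of_real (exp (s * t))"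
      using exp_converges[of "complex_of_real (s * t)"]
      unfolding exp_of_real by (simp add: scaleR_conv_of_real inverse_eq_divide)
    then show ?thesis by (rule sums_unique[symmetric])
  qed
  ultimately have "(\<lambda>m. complex_of_real (1 / fact m * (\<integral>t. t ^ m * w t \<partial>lborel) * s ^ m)) sums
      (\<integral>t. complex_of_real (exp (s * t) * w t) \<partial>lborel)"
    by simp
  then have sums: "(\<lambda>m. 1 / fact m * (\<integral>t. t ^ m * w t \<partial>lborel) * s ^ m) sums (\<integral>t. exp (s * t) * w t \<partial>lborel)"
    by (simp only: integral_complex_of_real sums_of_real_iff)
  have integral: "(\<integral>t. exp (s * t) * w t \<partial>lborel) =
      (LINT t:{0<..}|lborel. t ^ (n - 1) * (exp (- (\<delta> * t)) / (1 + exp (- t / 2))\<^sup>2))"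
    unfolding set_lebesgue_integral_def sech_sq_conv_exp unfolding minus_mult_left s_def[symmetric]
    by (intro Bochner_Integration.integral_cong) (simp_all add: w_def mult_ac)
  have moment: "(\<integral>t. t ^ m * w t \<partial>lborel) = 1 / 8 * 32 powr (real (m + n) / 2) *
      Gamma (real (m + n) / 2) * (LINT \<omega>|N. C \<omega> powr (- (real (m + n) / 2)))" for m
  proof -
    \<comment> \<open>With n = k + 1 the power is t^(m+k), and its moment formula is indexed by the
      successor m + k + 1 = m + n.\<close>
    obtain k where k: "n = Suc k" using n by (cases n) auto
    have "(\<integral>t. t ^ m * w t \<partial>lborel) =
        (\<integral>t. 1 / 4 * (indicator {0<..} t * (t ^ (m + k) * (1 / cosh (t / 4))\<^sup>2)) \<partial>lborel)"
      by (intro Bochner_Integration.integral_cong) (auto simp: w_def k power_add)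
    also have "\<dots> = 1 / 4 * (\<integral>t. indicator {0<..} t * (t ^ (m + k) * (1 / cosh (t / 4))\<^sup>2) \<partial>lborel)"
      by (rule integral_mult_right_zero)
    finally show ?thesis
      unfolding integral_power_sech_sq_eq_moment[OF C] k add_Suc_right by simp
  qed
  show ?thesis
    using sums unfolding integral moment by (simp add: s_def mult_ac)
qed

section \<open>The Riemann zeta and xi functions\<close>

definition exp_quot_fps :: "complex fps" where
  "exp_quot_fps = Abs_fps (\<lambda>m. 1 / fact (Suc m))"

text \<open>These are B_k / k!, where B_k are the Bernoulli numbers with B_1 = -1/2;
  \<open>exp_quot_fps\<close> is the Taylor series of (exp z - 1) / z.\<close>

definition bernoulli_coeff :: "nat \<Rightarrow> complex" where
  "bernoulli_coeff k = fps_nth (inverse exp_quot_fps) k"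

lemma bernoulli_coeff_0: "bernoulli_coeff 0 = 1"
  by (simp add: bernoulli_coeff_def exp_quot_fps_def)

lemma bernoulli_coeff_1: "bernoulli_coeff (Suc 0) = - 1 / 2"
proof -
  have "inverse exp_quot_fps * exp_quot_fps = 1"
    by (rule inverse_mult_eq_1) (simp add: exp_quot_fps_def)
  then have "fps_nth (inverse exp_quot_fps * exp_quot_fps) 1 = 0" by simp
  then show ?thesis
    by (simp add: fps_mult_nth_1 bernoulli_coeff_def exp_quot_fps_def add_eq_0_iff)
qed

text \<open>The nonzero roots of exp z = 1 are nonzero multiples of 2 pi i, so (exp z - 1)/z has no
  zero in the disc of radius 2 and its reciprocal is holomorphic there. This disc contains the
  interval [0, 1] with room to spare.\<close>

lemma bernoulli_coeff_sums:
  assumes "norm z < 2"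
  shows "(\<lambda>k. bernoulli_coeff k * z ^ k) sums (if z = 0 then 1 else z / (exp z - 1))"
proof -
  define E where "E = (\<lambda>z::complex. if z = 0 then 1 else (exp z - 1) / z)"
  have E_sums: "(\<lambda>m. fps_nth exp_quot_fps m * z ^ m) sums E z" for z
  proof (cases "z = 0")
    case False
    have "(\<lambda>m. z ^ Suc m / fact (Suc m) / z) sums ((exp z - 1) / z)"
      by (intro sums_divide exp_minus_one_sums)
    then show ?thesis using False by (simp add: E_def exp_quot_fps_def)
  next
    case True
    then show ?thesis
      using powser_sums_zero[of "fps_nth exp_quot_fps"] by (simp add: E_def exp_quot_fps_def)
  qed
  have "E has_fps_expansion exp_quot_fps"
    by (rule has_fps_expansionI) (simp add: E_sums)
  then have expansion: "(\<lambda>z. inverse (E z)) has_fps_expansion inverse exp_quot_fps"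
    by (rule has_fps_expansion_inverse) (simp add: exp_quot_fps_def)
  have "E holomorphic_on ball 0 2"
    by (rule power_series_holomorphic[where a = "fps_nth exp_quot_fps"]) (simp add: E_sums)
  moreover have "E z \<noteq> 0" if "z \<in> ball 0 2" for z
  proof (cases "z = 0")
    case False
    have "exp z \<noteq> 1"
    proof
      assume "exp z = 1"
      then obtain n where n: "Re z = 0" "Im z = of_int (2 * n) * pi" by (auto simp: exp_eq_1)
      with False have "n \<noteq> 0" by (auto simp: complex_eq_iff)
      then have "2 * pi \<le> \<bar>Im z\<bar>"
        by (simp add: n abs_mult)
      also have "\<dots> < 2" using that abs_Im_le_cmod[of z] by simp
      finally show False using pi_gt3 by simp
    qed
    then show ?thesis using False by (simp add: E_def)
  qed (simp add: E_def)
  ultimately have "(\<lambda>z. inverse (E z)) holomorphic_on eball 0 2"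
    by (intro holomorphic_intros) (simp_all add: eball_def ball_def)
  from has_fps_expansion_imp_sums_complex[OF expansion this, of z] assms
  show ?thesis by (auto simp: bernoulli_coeff_def E_def)
qed

text \<open>Convergence at 3/2, a point between 1 and the radius 2, forces absolute convergence at
  1.\<close>

lemma summable_norm_bernoulli_coeff: "summable (\<lambda>k. norm (bernoulli_coeff k))"
  using powser_insidea[OF sums_summable[OF bernoulli_coeff_sums], of "3 / 2" 1] by simp

section \<open>Entire functions making up the continuation of zeta\<close>

definition zeta_tail_integral :: "complex \<Rightarrow> complex" where
  "zeta_tail_integral s =
     (\<integral>t. exp (s * of_real (ln t)) * of_real (indicator {1<..} t / (t * (exp t - 1))) \<partial>lborel)"

text \<open>With t^(s-1) written as exp(s ln t) / t, \<open>integral_power_series\<close> applies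
  with \<open>g = ln\<close>. The weight decays exponentially and so beats every power t^N, hence
  the series in s converges in the whole plane.\<close>

lemma zeta_tail_integral_holomorphic: "zeta_tail_integral holomorphic_on UNIV"
proof -
  define w where "w = (\<lambda>t::real. indicator {1<..} t / (t * (exp t - 1)))"
  have [measurable]: "w \<in> borel_measurable lborel" unfolding w_def by measurable
  have int: "integrable lborel (\<lambda>t. exp (real N * \<bar>ln t\<bar>) * \<bar>w t\<bar>)" for N
  proof (rule Bochner_Integration.integrable_bound)
    show "integrable lborel (\<lambda>t::real. 2 * (indicator {0<..} t * (t ^ N * exp (- (1 * t)))))"
      using has_bochner_integral_power_exp[of 1 N] by (simp add: has_bochner_integral_iff)
    have "exp (real N * ln t) * (1 / (t * (exp t - 1))) \<le> 2 * (t ^ N * exp (- t))" if "t > 1" for t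
    proof -
      \<comment> \<open>For t > 1 this gives e^t - 1 >= e^t / 2, so the weight is at most 2
        e^(-t).\<close>
      have "2 \<le> exp t" using exp_ge_add_one_self[of t] that by linarith
      then have "exp t / 2 \<le> 1 * (exp t - 1)" by simp
      also have "\<dots> \<le> t * (exp t - 1)" using that by (intro mult_right_mono) auto
      finally have "1 / (t * (exp t - 1)) \<le> 1 / (exp t / 2)" using that by (intro divide_left_mono) auto
      moreover have "exp (real N * ln t) = t ^ N"
        using that by (simp add: exp_of_nat_mult)
      ultimately show ?thesis
        using mult_left_mono[of "1 / (t * (exp t - 1))" "1 / (exp t / 2)" "t ^ N"] that
        by (simp add: exp_minus field_simps)
    qed
    then show "AE t in lborel. norm (exp (real N * \<bar>ln t\<bar>) * \<bar>w t\<bar>) \<le>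
        norm (2 * (indicator {0<..} t * (t ^ N * exp (- (1 * t)))))"
      by (intro AE_I2) (auto simp: w_def indicator_def abs_mult)
  qed measurable
  have "(\<lambda>m. of_real (1 / fact m * (\<integral>t. ln t ^ m * w t \<partial>lborel)) * s ^ m) sums zeta_tail_integral s"
    (is "(\<lambda>m. ?a m * _) sums _") for s
  proof -
    obtain N where N: "norm s \<le> real N" using real_arch_simple by blast
    have "(\<lambda>m. of_real (1 / fact m * (\<integral>t. ln t ^ m * w t \<partial>lborel)) * s ^ m) sums
        (\<integral>t. (\<Sum>m. of_real (1 / fact m) * (s * of_real (ln t)) ^ m) * complex_of_real (w t) \<partial>lborel)"
      by (rule integral_power_series[OF _ _ _ int N]) auto
    moreover have "(\<Sum>m. of_real (1 / fact m) * z ^ m) = exp z" for z :: complex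
      using exp_converges[of z]
      by (intro sums_unique[symmetric]) (simp add: scaleR_conv_of_real inverse_eq_divide)
    ultimately show ?thesis by (simp add: zeta_tail_integral_def w_def)
  qed
  then have "zeta_tail_integral holomorphic_on ball 0 r" for r
    by (intro power_series_holomorphic[where a = ?a]) (simp only: diff_zero)
  then have "zeta_tail_integral field_differentiable (at s)" for s
    by (rule holomorphic_on_imp_differentiable_at[of _ "ball 0 (norm s + 1)"]) auto
  then show ?thesis
    by (auto simp: holomorphic_on_def intro: field_differentiable_at_within)
qed

text \<open>
  The pole of \<open>b\<^sub>k\<^sub>+\<^sub>1 / (s + k)\<close> at \<open>s = - k\<close> is cancelled by the zero of \<open>rGamma\<close> there; writing
  \<open>rGamma s / (s + k)\<close> with a Pochhammer symbol makes each term entire.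
\<close>

definition zeta_series_term :: "nat \<Rightarrow> complex \<Rightarrow> complex" where
  "zeta_series_term k s = bernoulli_coeff (Suc k) * (pochhammer s k * rGamma (s + of_nat (Suc k)))"

lemma zeta_series_term_eq:
  assumes "s \<noteq> - of_nat k"
  shows "zeta_series_term k s = rGamma s * (bernoulli_coeff (Suc k) / (s + of_nat k))"
proof -
  have "s + of_nat k \<noteq> 0" using assms by (simp add: add_eq_0_iff2)
  moreover have "rGamma s = pochhammer s k * (s + of_nat k) * rGamma (s + of_nat (Suc k))"
    by (subst pochhammer_rGamma[of s "Suc k"]) (simp add: pochhammer_Suc)
  ultimately show ?thesis by (simp add: zeta_series_term_def)
qed

text \<open>The partial sums converge uniformly on every closed unit disc: once k >= \<bar>z\<bar> +
  2, each s in the disc around z satisfies \<bar>s + k\<bar> >= 1, and the terms are dominated by a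
  bound for \<open>rGamma\<close> times the summable coefficients.\<close>

lemma zeta_series_holomorphic: "(\<lambda>s. \<Sum>k. zeta_series_term k s) holomorphic_on UNIV"
proof (rule holomorphic_uniform_sequence[where f = "\<lambda>n s. \<Sum>k<n. zeta_series_term k s"])
  show "(\<lambda>s. \<Sum>k<n. zeta_series_term k s) holomorphic_on UNIV" for n
    unfolding zeta_series_term_def pochhammer_prod by (intro holomorphic_intros)
  fix z :: complex
  have "compact (rGamma ` cball z 1)"
    by (intro compact_continuous_image continuous_on_rGamma compact_cball)
  then obtain B where B: "\<And>s. s \<in> cball z 1 \<Longrightarrow> norm (rGamma s) \<le> B"
    using compact_imp_bounded bounded_iff by (metis imageI)
  have "uniform_limit (cball z 1) (\<lambda>n s. \<Sum>k<n. zeta_series_term k s) (\<lambda>s. \<Sum>k. zeta_series_term k s) sequentially"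
  proof (rule Weierstrass_m_test_ev)
    show "summable (\<lambda>k. B * norm (bernoulli_coeff (Suc k)))"
      using summable_norm_bernoulli_coeff by (intro summable_mult) (subst summable_Suc_iff)
    show "\<forall>\<^sub>F k in sequentially. \<forall>s\<in>cball z 1. norm (zeta_series_term k s) \<le> B * norm (bernoulli_coeff (Suc k))"
      using eventually_ge_at_top[of "nat \<lceil>norm z + 2\<rceil>"]
    proof eventually_elim
      case (elim k)
      show ?case
      proof
        fix s assume s: "s \<in> cball z 1"
        have "norm s \<le> norm z + 1"
          using norm_triangle_ineq2[of s z] s by (simp add: dist_norm norm_minus_commute)
        moreover have "norm z + 2 \<le> real k" using elim by linarith
        moreover have "real k \<le> norm (s + of_nat k) + norm s"
          using norm_triangle_ineq4[of "s + of_nat k" s] by simp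
        ultimately have "1 \<le> norm (s + of_nat k)" by linarith
        then have "s \<noteq> - of_nat k" by auto
        have "norm (zeta_series_term k s) = norm (rGamma s) * (norm (bernoulli_coeff (Suc k)) / norm (s + of_nat k))"
          by (simp add: zeta_series_term_eq[OF \<open>s \<noteq> - of_nat k\<close>] norm_mult norm_divide)
        also have "\<dots> \<le> B * (norm (bernoulli_coeff (Suc k)) / 1)"
          using B[OF s] \<open>1 \<le> norm (s + of_nat k)\<close> order_trans[OF norm_ge_zero B[OF s]]
          by (intro mult_mono divide_left_mono) auto
        finally show "norm (zeta_series_term k s) \<le> B * norm (bernoulli_coeff (Suc k))" by simp
      qed
    qed
  qed
  then show "\<exists>d>0. cball z d \<subseteq> UNIV \<and>
      uniform_limit (cball z d) (\<lambda>n s. \<Sum>k<n. zeta_series_term k s) (\<lambda>s. \<Sum>k. zeta_series_term k s) sequentially"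
    by (intro exI[of _ 1]) auto
qed simp

text \<open>Zeta without its polar part: the term of index 0 in the Bernoulli expansion, 1/(s - 1),
  is left out and carries the pole.\<close>

definition zeta_regular :: "complex \<Rightarrow> complex" where
  "zeta_regular s = (\<Sum>k. zeta_series_term k s) + rGamma s * zeta_tail_integral s"

lemma zeta_regular_holomorphic: "zeta_regular holomorphic_on A"
proof -
  have "zeta_regular holomorphic_on UNIV"
    unfolding zeta_regular_def[abs_def]
    by (intro holomorphic_intros zeta_series_holomorphic zeta_tail_integral_holomorphic)
  then show ?thesis by (rule holomorphic_on_subset) simp
qed

text \<open>The antiderivative is t^s / s. The norm of the integrand is a real power, treated first
  to obtain absolute integrability; its integral also supplies the L1 norms for the exchange of sum
  and integral in \<open>zeta_sums\<close>.\<close>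

lemma has_bochner_integral_powr_unit_interval:
  fixes s :: complex
  assumes s: "Re s > 0"
  shows "has_bochner_integral lborel (\<lambda>t. indicator {0<..1} t *\<^sub>R (of_real t powr (s - 1))) (1 / s)"
    and "has_bochner_integral lborel (\<lambda>t. norm (indicator {0<..1} t *\<^sub>R (complex_of_real t powr (s - 1)))) (1 / Re s)"
proof -
  let ?f = "\<lambda>t. complex_of_real t powr (s - 1)"
  have s0: "s \<noteq> 0" using s by auto
  have drop_0: "(f has_integral y) {0<..1}" if "(f has_integral y) {0..1}"
    for f :: "real \<Rightarrow> 'b::banach" and y
  proof (rule has_integral_spike_set_eq[THEN iffD1, OF _ _ that])
    show "negligible {x \<in> {0..1} - {0<..1}. f x \<noteq> 0}"
      by (rule negligible_subset[of "{0}"]) auto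
    have "{x \<in> {0<..1} - {0..1}. f x \<noteq> 0} = {}" by auto
    then show "negligible {x \<in> {0<..1} - {0..1}. f x \<noteq> 0}" by (simp only: negligible_empty)
  qed
  have norm_eq: "norm (?f t) = t powr (Re s - 1)" if "t \<ge> 0" for t
    using that by (subst norm_powr_real_powr) auto
  have "((\<lambda>t. t powr (Re s - 1)) has_integral 1 / Re s) {0..1}"
    using has_integral_powr_from_0[of "Re s - 1" 1] s by simp
  then have real: "((\<lambda>t. t powr (Re s - 1)) has_integral 1 / Re s) {0<..1}"
    by (rule drop_0)
  have real_abs: "(\<lambda>t. t powr (Re s - 1)) absolutely_integrable_on {0<..1}"
    using real by (intro nonnegative_absolutely_integrable_1) (auto simp: has_integral_iff)
  have real': "has_bochner_integral lborel (\<lambda>t. indicator {0<..1} t *\<^sub>R (t powr (Re s - 1))) (1 / Re s)"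
  proof -
    have "integrable lborel (\<lambda>t. indicator {0<..1} t *\<^sub>R (t powr (Re s - 1)))"
      using real_abs unfolding set_integrable_def
      by (subst (asm) integrable_completion) simp_all
    moreover have "(\<integral>t. indicator {0<..1} t *\<^sub>R (t powr (Re s - 1)) \<partial>lborel) = 1 / Re s"
      using set_lebesgue_integral_eq_integral(2)[OF real_abs] real
      by (subst integral_completion[symmetric]) (simp_all add: set_lebesgue_integral_def integral_unique)
    ultimately show ?thesis by (simp add: has_bochner_integral_iff)
  qed
  have "indicator {0<..1} t *\<^sub>R (t powr (Re s - 1)) = norm (indicator {0<..1} t *\<^sub>R ?f t)" for t :: real
    by (auto simp: indicator_def norm_eq)
  with real' show *: "has_bochner_integral lborel (\<lambda>t. norm (indicator {0<..1} t *\<^sub>R ?f t)) (1 / Re s)"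
    by (simp only:)
  \<comment> \<open>The integrand may be unbounded at 0, so the derivative is taken only in the
    interior; t^s / s is still continuous at 0 because Re s > 0.\<close>
  have "(?f has_integral (of_real 1 powr s / s - of_real 0 powr s / s)) {0..1}"
  proof (rule fundamental_theorem_of_calculus_interior)
    show "continuous_on {0..1} (\<lambda>t. of_real t powr s / s)"
      using s s0 by (intro continuous_intros) auto
    fix t :: real assume t: "t \<in> {0<..<1}"
    have "((\<lambda>z. z powr s / s) has_field_derivative (s * of_real t powr (s - 1)) / s) (at (of_real t))"
      using t by (intro DERIV_cdivide has_field_derivative_powr) auto
    then show "((\<lambda>t. of_real t powr s / s) has_vector_derivative ?f t) (at t)"
      using s0 by (intro has_vector_derivative_real_field) simp
  qed simp
  then have "(?f has_integral 1 / s) {0..1}" using s0 by simp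
  then have has: "(?f has_integral 1 / s) {0<..1}"
    by (rule drop_0)
  have int: "integrable lborel (\<lambda>t. indicator {0<..1} t *\<^sub>R ?f t)"
    using * by (subst integrable_norm_iff[symmetric]) (auto simp: has_bochner_integral_iff)
  then have abs: "?f absolutely_integrable_on {0<..1}"
    unfolding set_integrable_def by (subst integrable_completion) simp_all
  have "(\<integral>t. indicator {0<..1} t *\<^sub>R ?f t \<partial>lborel) = 1 / s"
    using set_lebesgue_integral_eq_integral(2)[OF abs] has
    by (subst integral_completion[symmetric]) (simp_all add: set_lebesgue_integral_def integral_unique)
  with int show "has_bochner_integral lborel (\<lambda>t. indicator {0<..1} t *\<^sub>R ?f t) (1 / s)"
    by (simp add: has_bochner_integral_iff)
qed

text \<open>The integral of \<open>\<phi>\<close> is computed through two series. On the whole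
  half-line the geometric series \<open>f\<close> yields Gamma(s) times the Dirichlet series; on (0,
  1] the Bernoulli series \<open>g\<close> yields the terms b_k / (s + k - 1). Both exchanges rest
  on summable L1 norms.\<close>

lemma zeta_sums:
  assumes s: "Re s > 1"
  shows "(\<lambda>n. 1 / of_nat (Suc n) powr s) sums (rGamma s / (s - 1) + zeta_regular s)"
proof -
  define \<sigma> where "\<sigma> = Re s"
  define f where "f = (\<lambda>n t. indicator {0<..} t *\<^sub>R
      (complex_of_real t powr (s - 1) * of_real (exp (- (real (Suc n) * t)))))"
  define g where "g = (\<lambda>k t. bernoulli_coeff k * (indicator {0<..1} t *\<^sub>R
      (complex_of_real t powr (s + of_nat k - 1 - 1))))"
  define \<phi> where "\<phi> = (\<lambda>t. complex_of_real t powr (s - 1) / of_real (exp t - 1))"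
  define T1 where "T1 = (LINT t:{0<..1}|lborel. \<phi> t)"
  have f: "has_bochner_integral lborel (f n) (Gamma s / of_nat (Suc n) powr s)" for n
    using has_bochner_integral_Gamma[of s "real (Suc n)"] s by (simp add: f_def)
  \<comment> \<open>Taking norms replaces s by its real part, so the L1 norms form a convergent
    series of exponent \<sigma> > 1.\<close>
  have norm_f: "(\<integral>t. norm (f n t) \<partial>lborel) = Gamma \<sigma> * real (Suc n) powr - \<sigma>" for n
  proof -
    have *: "has_bochner_integral lborel (\<lambda>t. Re (indicator {0<..} t *\<^sub>R
          (complex_of_real t powr (of_real \<sigma> - 1) * of_real (exp (- (real (Suc n) * t))))))
        (Re (Gamma (of_real \<sigma>) / of_real (real (Suc n)) powr of_real \<sigma>))"
      by (intro has_bochner_integral_bounded_linear[OF bounded_linear_Re] has_bochner_integral_Gamma)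
         (use s in \<open>auto simp: \<sigma>_def\<close>)
    have "Gamma (of_real \<sigma>) / of_real (real (Suc n)) powr of_real \<sigma> =
        complex_of_real (Gamma \<sigma> * real (Suc n) powr - \<sigma>)"
      using powr_of_real[of "real (Suc n)" \<sigma>]
      by (simp add: Gamma_complex_of_real powr_minus_divide del: of_nat_Suc)
    moreover have "Re (indicator {0<..} t *\<^sub>R
          (complex_of_real t powr (of_real \<sigma> - 1) * of_real (exp (- (real (Suc n) * t))))) = norm (f n t)" for t
    proof (cases "t > 0")
      case True
      have "norm (complex_of_real t powr (s - 1)) = t powr (\<sigma> - 1)"
        using True by (simp add: norm_powr_real_powr \<sigma>_def)
      then show ?thesis
        using True powr_of_real[of t "\<sigma> - 1"] by (simp add: f_def norm_mult)
    qed (simp add: f_def)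
    ultimately show ?thesis
      using * by (simp only: has_bochner_integral_iff Re_complex_of_real)
  qed
  have f_sums: "(\<lambda>n. f n t) sums (indicator {0<..} t *\<^sub>R \<phi> t)"
    and f_summable: "summable (\<lambda>n. norm (f n t))" for t
  proof -
    \<comment> \<open>The factor (e^t - 1) e^(-t) = 1 - e^(-t) is split off so that the remaining
      geometric series sums to exactly 1.\<close>
    have f_eq: "f n t = \<phi> t * (of_real ((exp t - 1) * exp (- t)) * of_real (exp (- t)) ^ n)" if "t > 0" for n
    proof -
      have "exp (- (real (Suc n) * t)) = exp (- t) ^ Suc n"
        by (simp only: exp_of_nat_mult[symmetric] mult_minus_right)
      also have "\<dots> = (exp t - 1) * exp (- t) * exp (- t) ^ n / (exp t - 1)"
        using that by simp
      finally show ?thesis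
        using that by (simp only: f_def \<phi>_def) simp
    qed
    have "(\<lambda>n. f n t) sums (indicator {0<..} t *\<^sub>R \<phi> t) \<and> summable (\<lambda>n. norm (f n t))"
    proof (cases "t > 0")
      case True
      have "(\<lambda>n. complex_of_real (exp (- t)) ^ n) sums (1 / (1 - of_real (exp (- t))))"
        using True by (intro geometric_sums) simp
      then have "(\<lambda>n. f n t) sums (\<phi> t * (of_real ((exp t - 1) * exp (- t)) * (1 / (1 - of_real (exp (- t))))))"
        unfolding f_eq[OF True] by (intro sums_mult)
      moreover have "complex_of_real ((exp t - 1) * exp (- t)) * (1 / (1 - of_real (exp (- t)))) = 1"
      proof -
        have "(exp t - 1) * exp (- t) = 1 - exp (- t)" by (simp add: algebra_simps flip: exp_add)
        moreover have "1 - exp (- t) \<noteq> 0" using True by simp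
        ultimately have "(exp t - 1) * exp (- t) * (1 / (1 - exp (- t))) = 1" by simp
        then show ?thesis by (metis of_real_1 of_real_diff of_real_divide of_real_mult)
      qed
      moreover have "summable (\<lambda>n. norm (\<phi> t * of_real ((exp t - 1) * exp (- t))) * exp (- t) ^ n)"
        using True by (intro summable_mult summable_geometric) simp
      then have "summable (\<lambda>n. norm (f n t))"
        unfolding f_eq[OF True] by (simp add: norm_mult norm_power mult.assoc)
      ultimately show ?thesis using True by simp
    qed (simp add: f_def)
    then show "(\<lambda>n. f n t) sums (indicator {0<..} t *\<^sub>R \<phi> t)" "summable (\<lambda>n. norm (f n t))"
      by simp_all
  qed
  have "summable (\<lambda>n. real n powr - \<sigma>)"
    using s by (simp add: summable_real_powr_iff \<sigma>_def)
  then have "summable (\<lambda>n. real (Suc n) powr - \<sigma>)"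
    by (subst summable_Suc_iff)
  then have "summable (\<lambda>n. \<integral>t. norm (f n t) \<partial>lborel)"
    unfolding norm_f by (rule summable_mult)
  moreover have "integrable lborel (f n)" for n
    using f by (simp add: has_bochner_integral_iff)
  ultimately have "(\<lambda>n. \<integral>t. f n t \<partial>lborel) sums (\<integral>t. (\<Sum>n. f n t) \<partial>lborel)"
    and "integrable lborel (\<lambda>t. (\<Sum>n. f n t))"
    using f_summable by (auto intro!: sums_integral integrable_suminf)
  then have Gamma_sums: "(\<lambda>n. Gamma s / of_nat (Suc n) powr s) sums (LINT t:{0<..}|lborel. \<phi> t)"
    and int_\<phi>: "set_integrable lborel {0<..} \<phi>"
    using f by (simp_all only: sums_unique[OF f_sums, symmetric] has_bochner_integral_iff
        set_lebesgue_integral_def set_integrable_def)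
  have Un: "{0<..1} \<union> {1<..} = {0::real<..}" by auto
  have "(LINT t:{0<..1} \<union> {1<..}|lborel. \<phi> t) = T1 + (LINT t:{1<..}|lborel. \<phi> t)"
    unfolding T1_def by (intro set_integral_Un set_integrable_subset[OF int_\<phi>]) auto
  also have "(LINT t:{1<..}|lborel. \<phi> t) = zeta_tail_integral s"
    unfolding zeta_tail_integral_def set_lebesgue_integral_def
  proof (intro Bochner_Integration.integral_cong refl)
    fix t :: real
    show "indicator {1<..} t *\<^sub>R \<phi> t =
        exp (s * of_real (ln t)) * of_real (indicator {1<..} t / (t * (exp t - 1)))"
      by (auto simp: indicator_def \<phi>_def powr_def Ln_of_real exp_diff algebra_simps simp flip: exp_of_real)
  qed
  finally have T: "(LINT t:{0<..}|lborel. \<phi> t) = T1 + zeta_tail_integral s"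
    by (simp only: Un)
  have g: "has_bochner_integral lborel (g k) (bernoulli_coeff k * (1 / (s + of_nat k - 1)))" for k
    unfolding g_def
    by (intro has_bochner_integral_mult_right has_bochner_integral_powr_unit_interval(1)) (use s in simp)
  have norm_g: "(\<integral>t. norm (g k t) \<partial>lborel) = norm (bernoulli_coeff k) * (1 / (\<sigma> + real k - 1))" for k
  proof -
    have "has_bochner_integral lborel (\<lambda>t. norm (bernoulli_coeff k) *
          norm (indicator {0<..1} t *\<^sub>R (complex_of_real t powr (s + of_nat k - 1 - 1))))
        (norm (bernoulli_coeff k) * (1 / Re (s + of_nat k - 1)))"
      by (intro has_bochner_integral_mult_right has_bochner_integral_powr_unit_interval(2)) (use s in simp)
    then show ?thesis
      unfolding g_def norm_mult by (subst has_bochner_integral_integral_eq) (simp_all add: \<sigma>_def)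
  qed
  have g_eq: "g k t = of_real t powr (s - 1 - 1) * (bernoulli_coeff k * of_real t ^ k)" if "t \<in> {0<..1}" for k t
  proof -
    have "complex_of_real t powr (s + of_nat k - 1 - 1) = of_real t powr (s - 1 - 1 + of_nat k)"
      by (simp add: algebra_simps)
    also have "\<dots> = of_real t powr (s - 1 - 1) * of_real t ^ k"
      using that by (simp add: powr_add)
    finally show ?thesis using that by (simp add: g_def)
  qed
  have g_sums: "(\<lambda>k. g k t) sums (indicator {0<..1} t *\<^sub>R \<phi> t)" for t
  proof (cases "t \<in> {0<..1}")
    case True
    have "(\<lambda>k. bernoulli_coeff k * of_real t ^ k) sums (of_real t / (exp (of_real t) - 1))"
      using bernoulli_coeff_sums[of "of_real t"] True by simp
    then have "(\<lambda>k. g k t) sums (of_real t powr (s - 1 - 1) * (of_real t / (exp (of_real t) - 1)))"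
      unfolding g_eq[OF True] by (rule sums_mult)
    moreover have "of_real t powr (s - 1 - 1) * of_real t = complex_of_real t powr (s - 1)"
      using True by (simp add: powr_diff power2_eq_square)
    ultimately show ?thesis using True by (simp add: \<phi>_def exp_of_real)
  qed (simp add: g_def)
  have g_summable: "summable (\<lambda>k. norm (g k t))" for t
  proof (cases "t \<in> {0<..1}")
    case True
    show ?thesis
    proof (rule summable_comparison_test')
      show "summable (\<lambda>k. norm (complex_of_real t powr (s - 1 - 1)) * norm (bernoulli_coeff k))"
        by (intro summable_mult summable_norm_bernoulli_coeff)
      show "norm (norm (g k t)) \<le> norm (complex_of_real t powr (s - 1 - 1)) * norm (bernoulli_coeff k)" for k
        using True power_le_one[of t k]
        by (simp add: g_eq norm_mult norm_power mult_left_le mult_left_mono)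
    qed
  qed (simp add: g_def)
  have "summable (\<lambda>k. norm (bernoulli_coeff k) * (1 / (\<sigma> + real k - 1)))"
  proof (rule summable_comparison_test')
    show "summable (\<lambda>k. norm (bernoulli_coeff k) * (1 / (\<sigma> - 1)))"
      by (intro summable_mult2 summable_norm_bernoulli_coeff)
    show "norm (norm (bernoulli_coeff k) * (1 / (\<sigma> + real k - 1))) \<le> norm (bernoulli_coeff k) * (1 / (\<sigma> - 1))" for k
      using s by (auto simp: \<sigma>_def intro!: mult_left_mono divide_left_mono)
  qed
  then have "(\<lambda>k. \<integral>t. g k t \<partial>lborel) sums (\<integral>t. (\<Sum>k. g k t) \<partial>lborel)"
    using g g_summable by (intro sums_integral) (auto simp: has_bochner_integral_iff norm_g)
  then have "(\<lambda>k. bernoulli_coeff k * (1 / (s + of_nat k - 1))) sums T1"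
    unfolding T1_def
    using g by (simp only: sums_unique[OF g_sums, symmetric] has_bochner_integral_iff set_lebesgue_integral_def)
  \<comment> \<open>Splitting off the term of index 0 isolates the pole at s = 1.\<close>
  then have "(\<lambda>k. bernoulli_coeff (Suc k) * (1 / (s + of_nat (Suc k) - 1))) sums (T1 - 1 / (s - 1))"
    by (subst sums_Suc_iff) (simp add: bernoulli_coeff_0)
  then have "(\<lambda>k. rGamma s * (bernoulli_coeff (Suc k) / (s + of_nat k))) sums (rGamma s * (T1 - 1 / (s - 1)))"
    by (intro sums_mult) simp
  moreover have "s \<noteq> - of_nat k" for k using s by auto
  ultimately have "(\<Sum>k. zeta_series_term k s) = rGamma s * (T1 - 1 / (s - 1))"
    by (simp add: zeta_series_term_eq sums_iff)
  then have "rGamma s * (T1 + zeta_tail_integral s) = rGamma s / (s - 1) + zeta_regular s"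
    by (simp add: zeta_regular_def algebra_simps)
  moreover have "(\<lambda>n. rGamma s * (Gamma s / of_nat (Suc n) powr s)) sums (rGamma s * (T1 + zeta_tail_integral s))"
    using Gamma_sums unfolding T by (rule sums_mult)
  ultimately have sums: "(\<lambda>n. rGamma s * (Gamma s / of_nat (Suc n) powr s)) sums
      (rGamma s / (s - 1) + zeta_regular s)"
    by (simp only:)
  have "s \<notin> \<int>\<^sub>\<le>\<^sub>0"
    using s by (auto elim!: nonpos_Ints_cases)
  then have "rGamma s * Gamma s = 1"
    by (simp add: rGamma_inverse_Gamma Gamma_eq_zero_iff)
  then show ?thesis
    using sums by (simp only: times_divide_eq_right)
qed

text \<open>The explicit formula witnesses existence for the \<open>SOME\<close> in the definition;
  the identity theorem on the connected punctured plane then shows that whichever function was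
  chosen agrees with it.\<close>

lemma riemann_zeta_eq:
  assumes "s \<noteq> 1"
  shows "riemann_zeta s = rGamma s / (s - 1) + zeta_regular s"
proof -
  let ?Z = "\<lambda>s. rGamma s / (s - 1) + zeta_regular s"
  let ?P = "\<lambda>f. f holomorphic_on (- {1}) \<and>
     (\<forall>s. Re s > 1 \<longrightarrow> (\<lambda>n. 1 / of_nat (Suc n) powr s) sums f s)"
  have Z: "?Z holomorphic_on - {1}"
    by (intro holomorphic_intros zeta_regular_holomorphic) auto
  then have "?P ?Z" by (intro conjI allI impI zeta_sums)
  then have *: "?P riemann_zeta"
    unfolding riemann_zeta_def by (rule someI[of ?P])
  show ?thesis
  proof (rule analytic_continuation_open[where s = "{s. Re s > 1}" and s' = "- {1}"
        and f = riemann_zeta and g = ?Z])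
    show "connected (- {1::complex})" by (rule connected_punctured_universe) simp
    show "{s. Re s > 1} \<noteq> {}" by (auto intro!: exI[of _ 2])
    show "riemann_zeta s = ?Z s" if "s \<in> {s. Re s > 1}" for s
      using that * by (intro sums_unique2[OF _ zeta_sums]) auto
  qed (use assms Z * in \<open>auto simp: open_halfspace_Re_gt\<close>)
qed

lemma riemann_zeta_holomorphic: "riemann_zeta holomorphic_on - {1}"
proof -
  have "(\<lambda>s. rGamma s / (s - 1) + zeta_regular s) holomorphic_on - {1}"
    by (intro holomorphic_intros zeta_regular_holomorphic) auto
  then show ?thesis
    by (rule holomorphic_transform) (simp add: riemann_zeta_eq)
qed

lemma riemann_zeta_sums: "Re s > 1 \<Longrightarrow> (\<lambda>n. 1 / of_nat (Suc n) powr s) sums riemann_zeta s"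
  using zeta_sums[of s] by (subst riemann_zeta_eq) auto

text \<open>At 0 the Pochhammer factors vanish for k > 0 and \<open>rGamma 0 = 0\<close> removes the
  tail and the polar part, so only b_1 = -1/2 remains.\<close>

lemma riemann_zeta_0: "riemann_zeta 0 = - 1 / 2"
proof -
  have "zeta_series_term k 0 = (if k = 0 then - 1 / 2 else 0)" for k
    by (cases k) (simp_all add: zeta_series_term_def bernoulli_coeff_1 pochhammer_rec)
  then have "(\<Sum>k. zeta_series_term k 0) = - 1 / 2"
    using suminf_finite[of "{0}" "\<lambda>k. zeta_series_term k 0"] by simp
  then show ?thesis by (simp add: riemann_zeta_eq zeta_regular_def)
qed

lemma riemann_zeta_residue: "((\<lambda>s. (s - 1) * riemann_zeta s) \<longlongrightarrow> 1) (at 1)"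
proof -
  have "continuous_on UNIV zeta_regular"
    by (rule holomorphic_on_imp_continuous_on[OF zeta_regular_holomorphic])
  then have "isCont zeta_regular 1" by (simp add: continuous_on_eq_continuous_at)
  moreover have "isCont rGamma (1::complex)"
    using continuous_on_rGamma[of "UNIV :: complex set"] by (simp add: continuous_on_eq_continuous_at)
  ultimately have "((\<lambda>s. rGamma s + (s - 1) * zeta_regular s) \<longlongrightarrow> rGamma 1 + (1 - 1) * zeta_regular 1) (at 1)"
    by (intro tendsto_intros) (auto simp: isCont_def)
  moreover have "\<forall>\<^sub>F s in at 1. rGamma s + (s - 1) * zeta_regular s = (s - 1) * riemann_zeta s"
    unfolding eventually_at_filter
    by (intro always_eventually) (auto simp: riemann_zeta_eq field_simps)
  ultimately show ?thesis
    by (auto intro: Lim_transform_eventually)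
qed

section \<open>Values of xi at 0, at 1 and to the right of 1\<close>

lemma riemann_xi_0: "riemann_xi 0 = 1 / 2"
  unfolding riemann_xi_def
proof (rule remove_sings_eqI)
  have "isCont riemann_zeta 0"
    using holomorphic_on_imp_continuous_on[OF riemann_zeta_holomorphic]
    by (simp add: continuous_on_eq_continuous_at open_Compl)
  then have zeta: "(riemann_zeta \<longlongrightarrow> - 1 / 2) (at 0)"
    by (simp add: isCont_def riemann_zeta_0)
  \<comment> \<open>Absorbing q/2 into Gamma(q/2) = Gamma(q/2 + 1) / (q/2) removes the singularity
    at 0.\<close>
  have "((\<lambda>q. (q - 1) * of_real pi powr (- q / 2) * Gamma (q / 2 + 1) * riemann_zeta q) \<longlongrightarrow>
      (0 - 1) * of_real pi powr (- 0 / 2) * Gamma (0 / 2 + 1) * (- 1 / 2)) (at (0::complex))"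
    by (intro tendsto_intros zeta) (auto simp: pi_gt_zero[unfolded not_le[symmetric]])
  moreover have "\<forall>\<^sub>F q in at (0::complex).
      (q - 1) * of_real pi powr (- q / 2) * Gamma (q / 2 + 1) * riemann_zeta q =
      1 / 2 * q * (q - 1) * of_real pi powr (- q / 2) * Gamma (q / 2) * riemann_zeta q"
  proof -
    have "\<forall>\<^sub>F q in at (0::complex). q \<in> ball 0 1 - {0}"
      by (intro eventually_at_in_open) auto
    then show ?thesis
    proof eventually_elim
      case (elim q)
      have "q / 2 \<notin> \<int>\<^sub>\<le>\<^sub>0"
      proof
        assume "q / 2 \<in> \<int>\<^sub>\<le>\<^sub>0"
        then obtain k where k: "q / 2 = - of_nat k" by (elim nonpos_Ints_cases')
        then have "q = - of_nat (2 * k)" by (simp add: field_simps)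
        then have "norm q = real (2 * k)" by (metis norm_minus_cancel norm_of_nat)
        with elim show False by (cases k) auto
      qed
      then show ?case by (simp add: Gamma_plus1)
    qed
  qed
  ultimately show "((\<lambda>q. 1 / 2 * q * (q - 1) * of_real pi powr (- q / 2) * Gamma (q / 2) * riemann_zeta q) \<longlongrightarrow> 1 / 2) (at 0)"
    by (auto intro: Lim_transform_eventually)
qed

text \<open>The factor q - 1 is paired with zeta, where it has limit 1, and pi^(-1/2) Gamma(1/2) =
  1.\<close>

lemma riemann_xi_1: "riemann_xi 1 = 1 / 2"
  unfolding riemann_xi_def
proof (rule remove_sings_eqI)
  have "((\<lambda>q. 1 / 2 * q * of_real pi powr (- q / 2) * Gamma (q / 2) * ((q - 1) * riemann_zeta q)) \<longlongrightarrow>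
      1 / 2 * 1 * of_real pi powr (- 1 / 2) * Gamma (1 / 2) * 1) (at (1::complex))"
    by (intro tendsto_intros riemann_zeta_residue)
       (auto elim!: nonpos_Ints_cases simp: complex_eq_iff pi_gt_zero[unfolded not_le[symmetric]])
  moreover have "complex_of_real pi powr (- 1 / 2) * Gamma (1 / 2) = 1"
  proof -
    have "complex_of_real pi powr (- 1 / 2) = of_real (pi powr (- 1 / 2))"
      by (simp flip: powr_of_real)
    also have "pi powr (- 1 / 2) = 1 / sqrt pi"
      using powr_minus_divide[of pi "1 / 2"] by (simp add: powr_half_sqrt)
    finally show ?thesis by (simp add: Gamma_one_half_complex)
  qed
  ultimately show "((\<lambda>q. 1 / 2 * q * (q - 1) * of_real pi powr (- q / 2) * Gamma (q / 2) * riemann_zeta q) \<longlongrightarrow> 1 / 2) (at 1)"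
    by (simp add: mult_ac)
qed

lemma riemann_xi_of_Re_gt_1:
  assumes q: "Re q > 1"
  shows "riemann_xi q = 1 / 2 * q * (q - 1) * of_real pi powr (- q / 2) * Gamma (q / 2) * riemann_zeta q"
  unfolding riemann_xi_def
proof (rule remove_sings_at_analytic)
  have "q / 2 \<notin> \<int>\<^sub>\<le>\<^sub>0" if "Re q > 1" for q :: complex
    using that by (auto elim!: nonpos_Ints_cases simp: complex_eq_iff)
  then have "(\<lambda>q. 1 / 2 * q * (q - 1) * of_real pi powr (- q / 2) * Gamma (q / 2) * riemann_zeta q)
      holomorphic_on {s. Re s > 1}"
    by (intro holomorphic_intros holomorphic_on_subset[OF riemann_zeta_holomorphic]) auto
  then show "(\<lambda>q. 1 / 2 * q * (q - 1) * of_real pi powr (- q / 2) * Gamma (q / 2) * riemann_zeta q)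
      analytic_on {q}"
    using q by (auto simp: analytic_at open_halfspace_Re_gt intro!: exI[of _ "{s. Re s > 1}"])
qed

section \<open>The case of parameter one half\<close>

lemma set_integral_FTC_nonneg:
  fixes f F :: "real \<Rightarrow> real"
  assumes [measurable]: "f \<in> borel_measurable borel"
    and deriv: "\<And>x. a \<le> x \<Longrightarrow> DERIV F x :> f x" and nonneg: "\<And>x. a \<le> x \<Longrightarrow> 0 \<le> f x"
    and lim: "(F \<longlongrightarrow> T) at_top" and le: "F a \<le> T"
  shows "(LINT t:{a<..}|lborel. f t) = T - F a"
proof -
  have "(LINT t:{a<..}|lborel. f t) = enn2real (\<integral>\<^sup>+t. ennreal (indicator {a<..} t * f t) \<partial>lborel)"
    unfolding set_lebesgue_integral_def
    by (subst integral_eq_nn_integral) (auto simp: indicator_def intro!: nonneg AE_I2)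
  also have "(\<integral>\<^sup>+t. ennreal (indicator {a<..} t * f t) \<partial>lborel) = (\<integral>\<^sup>+t. ennreal (f t) * indicator {a..} t \<partial>lborel)"
    by (rule nn_integral_cong_AE, use AE_lborel_singleton[of a] in eventually_elim) (auto simp: indicator_def)
  also have "\<dots> = ennreal (T - F a)"
    by (rule nn_integral_FTC_atLeast[OF _ deriv nonneg lim]) auto
  finally show ?thesis using le by simp
qed

lemma one_plus_exp_pos: "0 < 1 + exp (x :: real)"
  by (intro add_pos_pos) auto

lemma logistic_integral_1:
  "(LINT t:{0<..}|lborel. exp (- (1 / 2 * t)) / (1 + exp (- t / 2))\<^sup>2) = (1 :: real)"
proof -
  define F where "F = (\<lambda>t::real. 2 / (1 + exp (- t / 2)))"
  have "(LINT t:{0<..}|lborel. exp (- (1 / 2 * t)) / (1 + exp (- t / 2))\<^sup>2) = 2 - F 0"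
  proof (rule set_integral_FTC_nonneg)
    show "DERIV F t :> exp (- (1 / 2 * t)) / (1 + exp (- t / 2))\<^sup>2" for t
      unfolding F_def using one_plus_exp_pos[of "- t / 2"]
      by (auto intro!: derivative_eq_intros simp: power2_eq_square)
    show "(F \<longlongrightarrow> 2) at_top" unfolding F_def by real_asymp
  qed (auto simp: F_def)
  then show ?thesis by (simp add: F_def)
qed

lemma logistic_integral_2:
  "(LINT t:{0<..}|lborel. t * (exp (- (1 / 2 * t)) / (1 + exp (- t / 2))\<^sup>2)) = (4 * ln 2 :: real)"
proof -
  \<comment> \<open>Integration by parts: 2/(1 + e^(-t/2)) is an antiderivative of the weight, and
    its own antiderivative is 4 ln(1 + e^(t/2)). Both terms grow like 2t, so \<open>F\<close> tends
    to 0.\<close>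
  define F where "F = (\<lambda>t::real. 2 * t / (1 + exp (- t / 2)) - 4 * ln (1 + exp (t / 2)))"
  have "(LINT t:{0<..}|lborel. t * (exp (- (1 / 2 * t)) / (1 + exp (- t / 2))\<^sup>2)) = 0 - F 0"
  proof (rule set_integral_FTC_nonneg)
    fix t :: real
    define A B where "A = 1 + exp (- t / 2)" and "B = 1 + exp (t / 2)"
    have pos: "0 < A" "0 < B" by (simp_all add: A_def B_def one_plus_exp_pos)
    have "((\<lambda>t. 2 * t / (1 + exp (- t / 2)) - 4 * ln (1 + exp (t / 2))) has_field_derivative
        (2 * A - 2 * t * (exp (- t / 2) * (- 1 / 2))) / (A * A) - 4 * (1 / B * (exp (t / 2) * (1 / 2)))) (at t)"
      unfolding A_def B_def using pos[unfolded A_def B_def] by (auto intro!: derivative_eq_intros)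
    also have "(2 * A - 2 * t * (exp (- t / 2) * (- 1 / 2))) / (A * A) - 4 * (1 / B * (exp (t / 2) * (1 / 2))) =
        2 / A + t * (exp (- (1 / 2 * t)) / A\<^sup>2) - 2 * (exp (t / 2) / B)"
      using pos by (simp add: field_simps power2_eq_square)
    finally have "(F has_field_derivative
        2 / (1 + exp (- t / 2)) + t * (exp (- (1 / 2 * t)) / (1 + exp (- t / 2))\<^sup>2)
        - 2 * (exp (t / 2) / (1 + exp (t / 2)))) (at t)"
      by (simp only: F_def A_def B_def)
    moreover have "exp (t / 2) / (1 + exp (t / 2)) = 1 / (1 + exp (- t / 2))"
      using one_plus_exp_pos[of "- t / 2"] one_plus_exp_pos[of "t / 2"]
      by (simp add: divide_simps algebra_simps flip: exp_add)
    ultimately show "DERIV F t :> t * (exp (- (1 / 2 * t)) / (1 + exp (- t / 2))\<^sup>2)" by simp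
  next
    show "(F \<longlongrightarrow> 0) at_top" unfolding F_def by real_asymp
  qed (auto simp: F_def)
  then show ?thesis by (simp add: F_def)
qed

section \<open>The alternating zeta series for n >= 3\<close>

lemma alternating_zeta_sums:
  assumes z: "(\<lambda>k. 1 / real (Suc k) ^ m) sums z"
  shows "(\<lambda>k. (- 1) ^ k / real (Suc k) ^ m) sums ((1 - 2 / 2 ^ m) * z)"
proof -
  have "(\<lambda>k. 2 / 2 ^ m * (1 / real (Suc k) ^ m)) sums (2 / 2 ^ m * z)"
    using z by (rule sums_mult)
  \<comment> \<open>Twice the sum over even integers is spread over the odd indices k, where k + 1
    is even, and subtracted from the full series.\<close>
  then have "(\<lambda>k. if even k then 0 else 2 / 2 ^ m * (1 / real (Suc ((k - 1) div 2)) ^ m)) sums (2 / 2 ^ m * z)"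
    by (rule sums_if')
  with z have "(\<lambda>k. 1 / real (Suc k) ^ m -
      (if even k then 0 else 2 / 2 ^ m * (1 / real (Suc ((k - 1) div 2)) ^ m))) sums (z - 2 / 2 ^ m * z)"
    by (rule sums_diff)
  moreover have "1 / real (Suc k) ^ m -
      (if even k then 0 else 2 / 2 ^ m * (1 / real (Suc ((k - 1) div 2)) ^ m)) = (- 1) ^ k / real (Suc k) ^ m" for k
  proof (cases "even k")
    case False
    then obtain j where k: "k = 2 * j + 1" by (elim oddE)
    have "real (Suc k) = 2 * real (Suc j)" by (simp add: k)
    then have "real (Suc k) ^ m = 2 ^ m * real (Suc j) ^ m" by (simp only: power_mult_distrib)
    moreover have "(k - 1) div 2 = j" by (simp add: k)
    ultimately show ?thesis using False by simp
  qed simp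
  ultimately show ?thesis by (simp add: algebra_simps)
qed

text \<open>With x = e^(-t/2), x/(1+x)^2 is the sum of (-1)^k (k+1) x^(k+1). The coefficient k + 1
  lowers the exponent of the integrated term from n to n - 1, and n - 1 >= 2 makes the L1 norms
  summable.\<close>

lemma logistic_integral_sums:
  assumes n: "n \<ge> 3"
  shows "(\<lambda>k. fact (n - 1) * 2 ^ n * ((- 1) ^ k / real (Suc k) ^ (n - 1))) sums
    (LINT t:{0<..}|lborel. t ^ (n - 1) * (exp (- (1 / 2 * t)) / (1 + exp (- t / 2))\<^sup>2))"
proof -
  obtain m where m: "n = Suc m" "m \<ge> 2" using n by (cases n) auto
  define e where "e = (\<lambda>k t. indicator {0<..} t * (t ^ m * exp (- (real (Suc k) / 2 * t))))"
  define h where "h = (\<lambda>k t. (- 1) ^ k * real (Suc k) * e k t)"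
  have e: "has_bochner_integral lborel (e k) (fact m / (real (Suc k) / 2) ^ Suc m)" for k
    unfolding e_def by (rule has_bochner_integral_power_exp) simp
  have e_const: "real (Suc k) * (fact m / (real (Suc k) / 2) ^ Suc m) = fact m * 2 ^ n * (1 / real (Suc k) ^ m)" for k
    by (simp add: m power_divide)
  have h: "integrable lborel (h k)" "(\<integral>t. h k t \<partial>lborel) = fact m * 2 ^ n * ((- 1) ^ k / real (Suc k) ^ m)" for k
  proof -
    have "has_bochner_integral lborel (h k) ((- 1) ^ k * real (Suc k) * (fact m / (real (Suc k) / 2) ^ Suc m))"
      unfolding h_def by (intro has_bochner_integral_mult_right e)
    then show "integrable lborel (h k)" "(\<integral>t. h k t \<partial>lborel) = fact m * 2 ^ n * ((- 1) ^ k / real (Suc k) ^ m)"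
      unfolding mult.assoc e_const by (simp_all add: has_bochner_integral_iff)
  qed
  have "(\<integral>t. norm (h k t) \<partial>lborel) = fact m * 2 ^ n * (1 / real (Suc k) ^ m)" for k
  proof -
    have "norm (h k t) = real (Suc k) * e k t" for t
      by (auto simp: h_def e_def abs_mult indicator_def)
    moreover have "has_bochner_integral lborel (\<lambda>t. real (Suc k) * e k t) (fact m * 2 ^ n * (1 / real (Suc k) ^ m))"
      unfolding e_const[symmetric] by (intro has_bochner_integral_mult_right e)
    ultimately show ?thesis by (simp add: has_bochner_integral_iff)
  qed
  moreover have "summable (\<lambda>k. 1 / real (Suc k) ^ m)"
    using inverse_power_summable[OF m(2), where ?'a = real] by (subst summable_Suc_iff) (simp add: inverse_eq_divide)
  ultimately have norm_h: "summable (\<lambda>k. \<integral>t. norm (h k t) \<partial>lborel)"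
    by (simp only: summable_mult)
  have h_sums: "(\<lambda>k. h k t) sums (indicator {0<..} t *\<^sub>R (t ^ m * (exp (- (1 / 2 * t)) / (1 + exp (- t / 2))\<^sup>2)))"
    and h_summable: "summable (\<lambda>k. norm (h k t))" for t
  proof -
    define x where "x = exp (- t / 2)"
    have h_eq: "h k t = t ^ m * x * (real (Suc k) * (- x) ^ k)" if "t > 0" for k
    proof -
      have "exp (- (real (Suc k) / 2 * t)) = x ^ Suc k"
        unfolding x_def exp_of_nat_mult[symmetric] by simp
      then show ?thesis using that by (simp add: h_def e_def power_minus')
    qed
    have "(\<lambda>k. h k t) sums (indicator {0<..} t *\<^sub>R (t ^ m * (exp (- (1 / 2 * t)) / (1 + exp (- t / 2))\<^sup>2))) \<and>
        summable (\<lambda>k. norm (h k t))"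
    proof (cases "t > 0")
      case True
      have x: "0 < x" "x < 1" using True by (simp_all add: x_def)
      have "(\<lambda>k. real (Suc k) * (- x) ^ k) sums (1 / (1 - (- x))\<^sup>2)"
        using geometric_deriv_sums[of "- x"] x by simp
      then have "(\<lambda>k. h k t) sums (t ^ m * x * (1 / (1 - (- x))\<^sup>2))"
        unfolding h_eq[OF True] by (rule sums_mult)
      moreover have "summable (\<lambda>k. t ^ m * x * (real (Suc k) * x ^ k))"
        using geometric_deriv_sums[of x] x by (intro summable_mult) (auto simp: sums_iff)
      then have "summable (\<lambda>k. norm (h k t))"
        unfolding h_eq[OF True] using True x by (simp add: abs_mult power_abs)
      ultimately show ?thesis using True by (simp add: x_def)
    qed (simp add: h_def e_def)
    then show "(\<lambda>k. h k t) sums (indicator {0<..} t *\<^sub>R (t ^ m * (exp (- (1 / 2 * t)) / (1 + exp (- t / 2))\<^sup>2)))"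
      "summable (\<lambda>k. norm (h k t))" by simp_all
  qed
  have "(\<lambda>k. \<integral>t. h k t \<partial>lborel) sums (\<integral>t. (\<Sum>k. h k t) \<partial>lborel)"
    using h_summable by (intro sums_integral h(1) norm_h) auto
  then show ?thesis
    by (simp only: sums_unique[OF h_sums, symmetric] h(2) set_lebesgue_integral_def m diff_Suc_1)
qed

section \<open>Matching the constants with xi\<close>

lemma Gamma_legendre_duplication_real:
  fixes x :: real
  assumes "x > 0"
  shows "Gamma x * Gamma (x + 1 / 2) = 2 powr (1 - 2 * x) * sqrt pi * Gamma (2 * x)"
proof -
  have "complex_of_real x \<notin> \<int>\<^sub>\<le>\<^sub>0" "complex_of_real x + 1 / 2 \<notin> \<int>\<^sub>\<le>\<^sub>0"
    using assms by (auto elim!: nonpos_Ints_cases simp: complex_eq_iff)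
  from Gamma_legendre_duplication[OF this]
  have "Gamma (complex_of_real x) * Gamma (complex_of_real (x + 1 / 2)) =
      of_real (exp ((1 - 2 * x) * ln 2)) * of_real (sqrt pi) * Gamma (complex_of_real (2 * x))"
    by (simp add: exp_of_real[symmetric])
  then have "complex_of_real (Gamma x * Gamma (x + 1 / 2)) =
      of_real (exp ((1 - 2 * x) * ln 2) * sqrt pi * Gamma (2 * x))"
    unfolding Gamma_complex_of_real by (simp only: of_real_mult)
  then show ?thesis
    by (simp only: of_real_eq_iff) (simp add: powr_def)
qed

text \<open>Duplication at (n-1)/2 merges the two Gamma values into 2^(2-n) sqrt(pi) (n-2)!. The
  factor n - 2 cancels against 1 - n/2 up to a sign, the exponents of 2 add up to n + 3 before
  division by 8, and the powers of pi cancel.\<close>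

lemma xi_constant:
  assumes n: "n \<ge> 3"
  shows "fact (n - 1) * 2 ^ n * (1 - 2 / 2 ^ (n - 1)) =
    32 powr (real n / 2) / 8 * Gamma (real n / 2) * ((2 powr (2 - real n) - 1) / (1 - real n / 2)) *
    (2 / pi) powr (1 - real n / 2) *
    (1 / 2 * (real n - 1) * (real n - 2) * pi powr (- (real n - 1) / 2) * Gamma ((real n - 1) / 2))"
    (is "_ = ?rhs")
proof -
  define r where "r = real n"
  have r: "r \<ge> 3" using n by (simp add: r_def)
  have two: "2 / 2 ^ (n - 1) = 2 powr (2 - r)"
  proof -
    have "(2::real) ^ (n - 1) = 2 powr (r - 1)"
      using n by (simp add: r_def of_nat_diff flip: powr_realpow)
    then show ?thesis
      using powr_diff[of 2 1 "r - 1"] by simp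
  qed
  have Gamma: "Gamma (r / 2) * Gamma ((r - 1) / 2) = 2 powr (2 - r) * pi powr (1 / 2) * fact (n - 2)"
  proof -
    have half: "(r - 1) / 2 + 1 / 2 = r / 2" "1 - 2 * ((r - 1) / 2) = 2 - r"
      by (simp_all add: field_simps)
    have "2 * ((r - 1) / 2) = 1 + real (n - 2)"
      using n by (simp add: r_def of_nat_diff)
    then have fact: "Gamma (2 * ((r - 1) / 2)) = fact (n - 2)"
      by (simp only: Gamma_fact)
    have "Gamma ((r - 1) / 2) * Gamma ((r - 1) / 2 + 1 / 2) =
        2 powr (1 - 2 * ((r - 1) / 2)) * sqrt pi * Gamma (2 * ((r - 1) / 2))"
      using r by (intro Gamma_legendre_duplication_real) simp
    then show ?thesis
      unfolding half fact by (simp add: powr_half_sqrt mult.commute)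
  qed
  have p32: "32 powr (r / 2) = 2 powr (5 * r / 2)"
    using powr_powr[of 2 5 "r / 2"] by simp
  have p2pi: "(2 / pi) powr (1 - r / 2) = 2 powr (1 - r / 2) * pi powr (r / 2 - 1)"
    using powr_minus_divide[of pi "1 - r / 2"] by (simp add: powr_divide)
  have ratio: "(2 powr (2 - r) - 1) / (1 - r / 2) * (1 / 2 * (r - 1) * (r - 2)) = (1 - 2 powr (2 - r)) * (r - 1)"
    using r by (simp add: field_simps)
  have "?rhs = ((2 powr (2 - r) - 1) / (1 - r / 2) * (1 / 2 * (r - 1) * (r - 2))) *
      (Gamma (r / 2) * Gamma ((r - 1) / 2)) * (2 powr (5 * r / 2) / 8) *
      (2 powr (1 - r / 2) * pi powr (r / 2 - 1)) * pi powr (- (r - 1) / 2)"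
    unfolding r_def[symmetric] p32 p2pi by (simp only: mult_ac)
  also have "\<dots> = (1 - 2 powr (2 - r)) * ((r - 1) * fact (n - 2)) *
      ((2 powr (2 - r) * 2 powr (5 * r / 2) * 2 powr (1 - r / 2)) / 8) *
      (pi powr (1 / 2) * pi powr (r / 2 - 1) * pi powr (- (r - 1) / 2))"
    unfolding ratio Gamma by (simp only: mult_ac times_divide_eq_right times_divide_eq_left)
  also have "(r - 1) * fact (n - 2) = fact (n - 1)"
  proof -
    obtain k where "n = Suc (Suc k)" using n by (auto simp: numeral_eq_Suc Suc_le_eq less_iff_Suc_add)
    then show ?thesis by (simp add: r_def)
  qed
  also have "2 powr (2 - r) * 2 powr (5 * r / 2) * 2 powr (1 - r / 2) = 2 powr (r + 3)"
    unfolding powr_add[symmetric] by (rule arg_cong[where f = "(powr) 2"]) (simp add: field_simps)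
  also have "2 powr (r + 3) / 8 = 2 ^ n"
    by (simp add: powr_add r_def powr_realpow)
  also have "pi powr (1 / 2) * pi powr (r / 2 - 1) * pi powr (- (r - 1) / 2) = 1"
    unfolding powr_add[symmetric] by (simp add: field_simps)
  finally show ?thesis unfolding two by (simp only: mult_ac mult_1_right)
qed

lemma cumulant_half_eq_xi:
  assumes n: "n \<ge> 1"
  shows "complex_of_real (LINT t:{0<..}|lborel. t ^ (n - 1) * (exp (- (1 / 2 * t)) / (1 + exp (- t / 2))\<^sup>2)) =
    complex_of_real (32 powr (real n / 2) / 8 * Gamma (real n / 2) *
      (if n = 2 then 2 * ln 2 else (2 powr (2 - real n) - 1) / (1 - real n / 2)) *
      (2 / pi) powr (1 - real n / 2)) * riemann_xi (of_nat n - 1)"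
proof -
  consider "n = 1" | "n = 2" | "n \<ge> 3" using n by linarith
  then show ?thesis
  proof cases
    case 1
    have sqrt: "32 powr (1 / 2) = sqrt 32" "(2 / pi) powr (1 / 2) = sqrt (2 / pi)"
      by (simp_all add: powr_half_sqrt)
    \<comment> \<open>The product under the root is 64, so the prefactor for n = 1 is 2, which xi(0)
      = 1/2 turns into the integral's value 1.\<close>
    have "32 powr (1 / 2) * sqrt pi * (2 / pi) powr (1 / 2) = sqrt (32 * pi * (2 / pi))"
      unfolding sqrt by (simp only: real_sqrt_mult)
    also have "\<dots> = 8"
      by (rule real_sqrt_unique) auto
    finally have "32 powr (1 / 2) / 8 * Gamma (1 / 2) * ((2 powr (2 - 1) - 1) / (1 - 1 / 2)) * (2 / pi) powr (1 - 1 / 2) = (2 :: real)"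
      by (simp add: Gamma_one_half_real mult_ac)
    then show ?thesis
      using logistic_integral_1 by (simp add: 1 riemann_xi_0)
  next
    case 2
    then show ?thesis
      using logistic_integral_2 by (simp add: riemann_xi_1)
  next
    case 3
    define z where "z = (\<Sum>k. 1 / real (Suc k) ^ (n - 1))"
    have z: "(\<lambda>k. 1 / real (Suc k) ^ (n - 1)) sums z"
      unfolding z_def using 3 inverse_power_summable[of "n - 1", where ?'a = real]
      by (intro summable_sums, subst summable_Suc_iff) (simp add: inverse_eq_divide)
    have "(\<lambda>k. complex_of_real (1 / real (Suc k) ^ (n - 1))) sums of_real z"
      using z by (simp only: sums_of_real_iff)
    moreover have "(\<lambda>k. 1 / complex_of_nat (Suc k) powr of_nat (n - 1)) sums riemann_zeta (of_nat (n - 1))"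
      using 3 by (intro riemann_zeta_sums) simp
    then have "(\<lambda>k. complex_of_real (1 / real (Suc k) ^ (n - 1))) sums riemann_zeta (of_nat (n - 1))"
      by (subst (asm) powr_nat') (use 3 in auto)
    ultimately have zeta: "riemann_zeta (of_nat (n - 1)) = of_real z"
      by (rule sums_unique2[symmetric])
    have xi: "riemann_xi (of_nat n - 1) = of_real (1 / 2 * (real n - 1) * (real n - 2) *
        pi powr (- (real n - 1) / 2) * Gamma ((real n - 1) / 2) * z)"
    proof -
      have q: "complex_of_nat n - 1 = of_nat (n - 1)" using 3 by (simp add: of_nat_diff)
      have "complex_of_real pi powr (- (of_nat n - 1) / 2) = of_real (pi powr (- (real n - 1) / 2))"
        by (subst powr_of_real[symmetric]) simp_all
      moreover have "Gamma ((of_nat n - 1) / 2) = complex_of_real (Gamma ((real n - 1) / 2))"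
        by (subst Gamma_complex_of_real[symmetric]) simp
      moreover have "riemann_zeta (of_nat n - 1) = of_real z" using zeta by (simp only: q)
      ultimately show ?thesis
        using 3 by (subst riemann_xi_of_Re_gt_1) (auto simp: algebra_simps)
    qed
    have "(LINT t:{0<..}|lborel. t ^ (n - 1) * (exp (- (1 / 2 * t)) / (1 + exp (- t / 2))\<^sup>2)) =
        fact (n - 1) * 2 ^ n * ((1 - 2 / 2 ^ (n - 1)) * z)"
      using logistic_integral_sums[OF 3] sums_mult[OF alternating_zeta_sums[OF z], of "fact (n - 1) * 2 ^ n"]
      by (rule sums_unique2)
    also have "\<dots> = fact (n - 1) * 2 ^ n * (1 - 2 / 2 ^ (n - 1)) * z" by (simp only: mult.assoc)
    finally show ?thesis
      unfolding xi_constant[OF 3] xi of_real_mult[symmetric] of_real_eq_iff using 3 by (simp add: mult_ac)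
  qed
qed

text \<open>Summability stands beside the value of the series because \<open>suminf\<close> is a
  total function, so the equation alone would not assert convergence.\<close>

theorem theorem6p2:
  fixes \<delta> :: real and n :: nat and M :: "real measure"
    and N :: "'a measure" and C :: "'a \<Rightarrow> real"
  assumes "0 < \<delta>" and "\<delta> < 1" and "n \<ge> 1"
    and "barnes_beta_22 \<delta> M"
  shows "(C2_variable N C \<longrightarrow>
      summable (\<lambda>m. (- (\<delta> - 1 / 2)) ^ m / fact m * 32 powr (real (m + n) / 2) *
        Gamma (real (m + n) / 2) * (LINT \<omega>|N. C \<omega> powr (- (real (m + n) / 2)))) \<and>
      neg_log_cumulant M n = complex_of_real (1 / 8 *
        (\<Sum>m. (- (\<delta> - 1 / 2)) ^ m / fact m * 32 powr (real (m + n) / 2) *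
          Gamma (real (m + n) / 2) * (LINT \<omega>|N. C \<omega> powr (- (real (m + n) / 2)))))) \<and>
    (\<delta> = 1 / 2 \<longrightarrow>
      neg_log_cumulant M n =
        complex_of_real (32 powr (real n / 2) / 8 * Gamma (real n / 2) *
          (if n = 2 then 2 * ln 2 else (2 powr (2 - real n) - 1) / (1 - real n / 2)) *
          (2 / pi) powr (1 - real n / 2)) *
        riemann_xi (of_nat n - 1))"
proof -
  have \<kappa>: "neg_log_cumulant M n = complex_of_real
      (LINT t:{0<..}|lborel. t ^ (n - 1) * (exp (- (\<delta> * t)) / (1 + exp (- t / 2))\<^sup>2))"
    using assms by (intro neg_log_cumulant_eq_integral)
  show ?thesis
  proof (intro conjI impI)
    assume C: "C2_variable N C"
    let ?a = "\<lambda>m. (- (\<delta> - 1 / 2)) ^ m / fact m * 32 powr (real (m + n) / 2) *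
        Gamma (real (m + n) / 2) * (LINT \<omega>|N. C \<omega> powr (- (real (m + n) / 2)))"
    have sums: "(\<lambda>m. 1 / 8 * ?a m) sums
        (LINT t:{0<..}|lborel. t ^ (n - 1) * (exp (- (\<delta> * t)) / (1 + exp (- t / 2))\<^sup>2))"
      using cumulant_integral_sums[OF C assms(1-3)] .
    from sums_mult[OF sums, of 8] show summable: "summable ?a"
      by (simp add: sums_iff)
    show "neg_log_cumulant M n = complex_of_real (1 / 8 * suminf ?a)"
      unfolding \<kappa> suminf_mult[OF summable, symmetric] sums_unique[OF sums, symmetric] ..
  next
    assume "\<delta> = 1 / 2"
    with \<kappa> show "neg_log_cumulant M n =
        complex_of_real (32 powr (real n / 2) / 8 * Gamma (real n / 2) *
          (if n = 2 then 2 * ln 2 else (2 powr (2 - real n) - 1) / (1 - real n / 2)) *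
          (2 / pi) powr (1 - real n / 2)) *
        riemann_xi (of_nat n - 1)"
      using cumulant_half_eq_xi[OF assms(3)] by (simp only:)
  qed
qed

end
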